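(* Let $n\ge3$ and fix $\beta$ with $|\beta|\le1$. In the general stable location-scale family with characteristic exponent $\alpha$ and skewness parameter $\beta$ described in the context, consider testing $H_0:\alpha=2$ against $H_1:\alpha<2$ on the basis of i.i.d. observations $x_1,\dots,x_n$ with unknown location and scale. Write $\theta=2-\alpha$, let $f(x;\theta)$ be the standard stable density with exponent $2-\theta$ and skewness $\beta$ (so that $f(\cdot;0)$ is the $N(0,2)$ density), and let $$l_\theta(x;0)=\frac{1}{f(x;0)}\left(-\frac{1}{2\pi}\int_{-\infty}^\infty e^{-itx}\,\frac{\partial}{\partial\alpha}\Phi(t;\alpha,\beta)\Big|_{\alpha=2}\,dt\right)$$ be the score function at $\theta=0$. Then the locally best invariant test is given by the rejection region $$T(z_1,\dots,z_n)=\int_0^\infty\int_{-\infty}^\infty\sum_{i=1}^n l_\theta(a+bz_i;0)\exp\Big(-\frac{n(a^2+b^2)}{4}\Big)b^{n-2}\,da\,db>k ,$$ where $z_1,\dots,z_n$ are the standardized observations.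
   Context: The standard stable distribution with characteristic exponent $\alpha$ ($0<\alpha\le2$; the formula is for $\alpha\ne1$) and skewness parameter $\beta$, $|\beta|\le1$, in Zolotarev's (M) parameterization, has characteristic function $$\Phi(t;\alpha,\beta)=\exp\left(-|t|^{\alpha}\left\{1+i\beta(\mathrm{sgn}\,t)\tan\left(\frac{\pi\alpha}{2}\right)(|t|^{1-\alpha}-1)\right\}\right)$$ and density $g(x;\alpha,\beta)=\frac1{2\pi}\int_{-\infty}^\infty e^{-itx}\Phi(t;\alpha,\beta)\,dt$. Put $f(x;\theta)=g(x;2-\theta,\beta)$ and $f_{a,b}(x;\theta)=\frac1b f\left(\frac{x-a}{b};\theta\right)$ for $a\in\mathbb{R}$, $b>0$. For $\theta=0$ this is the normal location-scale family with standard member $N(0,2)$. The derivative in $\alpha$ at $\alpha=2$ is the one-sided derivative. The observations are i.i.d. from $f_{a,b}(x;\theta)$. The standardized observations are $z_i=(x_i-\bar x)/s$, with $\bar x=\frac1n\sum_jx_j$, $s^2=\frac1n\sum_j(x_j-\bar x)^2$. A critical (rejection) region $R\subset\mathbb{R}^n$ is invariant if $(x_1,\dots,x_n)\in R\Leftrightarrow(a+bx_1,\dots,a+bx_n)\in R$ for all $a\in\mathbb{R}$, $b>0$; the probability $P_\theta(R)$ of an invariant region depends only on $\theta$, not on $(a,b)$. An invariant region $R$ is the rejection region of a locally best invariant (LBI) test (of size $P_0(R)$) if for every invariant region $R'$ with $P_0(R')\le P_0(R)$ there is $\theta_0>0$ such that $P_\theta(R)\ge P_\theta(R')$ for all $0<\theta<\theta_0$.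 *)

theory Defs
  imports "HOL-Analysis.Analysis"
begin

section \<open>The stable family in Zolotarev's (M) parameterization\<close>

text \<open>
  The formula is meaningful for \<open>0 < \<alpha> \<le> 2\<close>, \<open>\<alpha> \<noteq> 1\<close>. At \<open>t = 0\<close> the library conventions
  \<open>0 powr _ = 0\<close> and \<open>sgn 0 = 0\<close> give the correct value 1.
\<close>

definition stable_cf :: "real \<Rightarrow> real \<Rightarrow> real \<Rightarrow> complex" where
  "stable_cf t \<alpha> \<beta> =
     exp (- complex_of_real (\<bar>t\<bar> powr \<alpha>) *
          (1 + \<i> * complex_of_real
                (\<beta> * sgn t * tan (pi * \<alpha> / 2) * (\<bar>t\<bar> powr (1 - \<alpha>) - 1))))"

text \<open>
  The inversion integral is real, because the integrand at \<open>- t\<close> is the complex conjugate of the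
  integrand at \<open>t\<close>; \<open>Re\<close> only changes the type. The same applies to the score below.
\<close>

definition stable_density :: "real \<Rightarrow> real \<Rightarrow> real \<Rightarrow> real" where
  "stable_density x \<alpha> \<beta> =
     Re (1 / (2 * complex_of_real pi) * (CLINT t|lborel. exp (- \<i> * of_real t * of_real x) * stable_cf t \<alpha> \<beta>))"

definition std_density :: "real \<Rightarrow> real \<Rightarrow> real \<Rightarrow> real" where
  "std_density \<beta> x \<theta> = stable_density x (2 - \<theta>) \<beta>"

definition ls_density :: "real \<Rightarrow> real \<Rightarrow> real \<Rightarrow> real \<Rightarrow> real \<Rightarrow> real" where
  "ls_density \<beta> a b x \<theta> = 1 / b * std_density \<beta> ((x - a) / b) \<theta>"

text \<open>Since \<open>\<alpha> \<le> 2\<close>, the derivative in \<open>\<alpha>\<close> at 2 is taken within the parameter range.\<close>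

definition score0 :: "real \<Rightarrow> real \<Rightarrow> real" where
  "score0 \<beta> x =
     1 / std_density \<beta> x 0 *
     Re (- (1 / (2 * complex_of_real pi)) *
          (CLINT t|lborel. exp (- \<i> * of_real t * of_real x) *
             vector_derivative (\<lambda>\<alpha>. stable_cf t \<alpha> \<beta>) (at 2 within {0<..2})))"


section \<open>Samples, invariant regions and locally best invariant tests\<close>

text \<open>A point of \<open>\<real>\<^sup>n\<close> is a function on \<open>{..<n}\<close>, extended by \<open>undefined\<close>.\<close>

abbreviation sample_space :: "nat \<Rightarrow> (nat \<Rightarrow> real) measure" where
  "sample_space n \<equiv> PiM {..<n} (\<lambda>_. borel)"

definition stable_sample :: "nat \<Rightarrow> real \<Rightarrow> real \<Rightarrow> real \<Rightarrow> real \<Rightarrow> (nat \<Rightarrow> real) measure" where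
  "stable_sample n \<beta> a b \<theta> =
     PiM {..<n} (\<lambda>_. density lborel (\<lambda>x. ennreal (ls_density \<beta> a b x \<theta>)))"

definition affine_sample :: "nat \<Rightarrow> real \<Rightarrow> real \<Rightarrow> (nat \<Rightarrow> real) \<Rightarrow> nat \<Rightarrow> real" where
  "affine_sample n a b x = (\<lambda>i\<in>{..<n}. a + b * x i)"

definition invariant_region :: "nat \<Rightarrow> (nat \<Rightarrow> real) set \<Rightarrow> bool" where
  "invariant_region n R \<longleftrightarrow>
     R \<in> sets (sample_space n) \<and>
     (\<forall>x \<in> space (sample_space n). \<forall>a b. b > 0 \<longrightarrow> (x \<in> R \<longleftrightarrow> affine_sample n a b x \<in> R))"

text \<open>
  \<open>P \<theta>\<close> is the distribution of the sample; the null hypothesis is \<open>\<theta> = 0\<close>, the alternative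
  \<open>\<theta> > 0\<close>. Only arbitrarily small \<open>\<theta>\<close> matter, so the values of \<open>P\<close> outside the parameter range
  are irrelevant.
\<close>

definition lbi_region :: "nat \<Rightarrow> (real \<Rightarrow> (nat \<Rightarrow> real) measure) \<Rightarrow> (nat \<Rightarrow> real) set \<Rightarrow> bool" where
  "lbi_region n P R \<longleftrightarrow>
     invariant_region n R \<and>
     (\<forall>R'. invariant_region n R' \<and> measure (P 0) R' \<le> measure (P 0) R \<longrightarrow>
        (\<exists>\<theta>0>0. \<forall>\<theta>. 0 < \<theta> \<and> \<theta> < \<theta>0 \<longrightarrow> measure (P \<theta>) R \<ge> measure (P \<theta>) R'))"


section \<open>The test statistic\<close>

definition sample_mean :: "nat \<Rightarrow> (nat \<Rightarrow> real) \<Rightarrow> real" where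
  "sample_mean n x = 1 / real n * (\<Sum>j<n. x j)"

definition sample_sd :: "nat \<Rightarrow> (nat \<Rightarrow> real) \<Rightarrow> real" where
  "sample_sd n x = sqrt (1 / real n * (\<Sum>j<n. (x j - sample_mean n x)\<^sup>2))"

text \<open>If all observations coincide (a null event), division by zero makes every \<open>z i\<close> zero.\<close>

definition standardize :: "nat \<Rightarrow> (nat \<Rightarrow> real) \<Rightarrow> nat \<Rightarrow> real" where
  "standardize n x i = (x i - sample_mean n x) / sample_sd n x"

definition T_stat :: "nat \<Rightarrow> real \<Rightarrow> (nat \<Rightarrow> real) \<Rightarrow> real" where
  "T_stat n \<beta> z =
     (LINT b:{0<..}|lborel. LINT a|lborel.
        (\<Sum>i<n. score0 \<beta> (a + b * z i)) * exp (- (real n * (a\<^sup>2 + b\<^sup>2) / 4)) * b ^ (n - 2))"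


section \<open>Consistency of the definitions\<close>

lemma stable_cf_2: "stable_cf t 2 \<beta> = exp (- complex_of_real (t\<^sup>2))"
  by (cases "t = 0") (simp_all add: stable_cf_def)

lemma stable_density_measurable [measurable]:
  "(\<lambda>x. stable_density x \<alpha> \<beta>) \<in> borel_measurable borel"
proof -
  have [measurable]: "(\<lambda>t. stable_cf t \<alpha> \<beta>) \<in> borel_measurable borel"
    unfolding stable_cf_def by measurable
  have [measurable]: "case_prod (\<lambda>x t. exp (- \<i> * of_real t * of_real x) * stable_cf t \<alpha> \<beta>)
      \<in> borel_measurable (borel \<Otimes>\<^sub>M lborel)"
    by measurable
  show ?thesis
    unfolding stable_density_def by measurable
qed

lemma ls_density_measurable [measurable]:
  "(\<lambda>x. ls_density \<beta> a b x \<theta>) \<in> borel_measurable borel"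
  unfolding ls_density_def std_density_def by measurable

lemma stable_distr_affine:
  fixes a b :: real
  assumes b: "b > 0" and [measurable]: "A \<in> sets borel"
  shows "emeasure (density lborel (\<lambda>x. ennreal (ls_density \<beta> 0 1 x \<theta>))) {x. a + b * x \<in> A} =
         emeasure (density lborel (\<lambda>x. ennreal (ls_density \<beta> a b x \<theta>))) A"
proof -
  have [measurable]: "{x. a + b * x \<in> A} \<in> sets borel"
    by measurable
  have eq: "ennreal \<bar>b\<bar> * (ennreal (ls_density \<beta> a b (a + b * x) \<theta>) * indicator A (a + b * x)) =
      ennreal (ls_density \<beta> 0 1 x \<theta>) * indicator {x. a + b * x \<in> A} x" for x
    using b by (auto simp: ls_density_def indicator_def ennreal_mult'[symmetric])
  have "emeasure (density lborel (\<lambda>x. ennreal (ls_density \<beta> a b x \<theta>))) A =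
      (\<integral>\<^sup>+x. ennreal (ls_density \<beta> a b x \<theta>) * indicator A x \<partial>lborel)"
    by (subst emeasure_density) auto
  also have "\<dots> = \<bar>b\<bar> * (\<integral>\<^sup>+x. ennreal (ls_density \<beta> a b (a + b * x) \<theta>) * indicator A (a + b * x) \<partial>lborel)"
    by (rule nn_integral_real_affine) (use b in auto)
  also have "\<dots> = (\<integral>\<^sup>+x. ennreal (ls_density \<beta> 0 1 x \<theta>) * indicator {x. a + b * x \<in> A} x \<partial>lborel)"
    by (subst nn_integral_cmult[symmetric], measurable) (simp only: eq)
  also have "\<dots> = emeasure (density lborel (\<lambda>x. ennreal (ls_density \<beta> 0 1 x \<theta>))) {x. a + b * x \<in> A}"
    by (subst emeasure_density) auto
  finally show ?thesis ..
qed

lemma stable_sample_affine: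
  assumes b: "b > 0"
  shows "distr (stable_sample n \<beta> 0 1 \<theta>) (sample_space n) (affine_sample n a b) =
         stable_sample n \<beta> a b \<theta>"
proof -
  define M where "M a b = density lborel (\<lambda>x. ennreal (ls_density \<beta> a b x \<theta>))" for a b
  have sf: "product_sigma_finite (\<lambda>_::nat. M a b)" for a b
    unfolding product_sigma_finite_def M_def
    by (subst sigma_finite_measure.sigma_finite_iff_density_finite[OF lborel.sigma_finite_measure_axioms]) auto
  have sets_M: "sets (M a b) = sets borel" for a b
    by (simp add: M_def)
  have space_M: "space (M a b) = UNIV" for a b
    by (simp add: M_def)
  have sets_P: "sets (PiM {..<n} (\<lambda>_. M a b)) = sets (sample_space n)" for a b
    by (intro sets_PiM_cong refl sets_M)
  have aff: "affine_sample n a b \<in> measurable (PiM {..<n} (\<lambda>_. M 0 1)) (sample_space n)"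
    unfolding measurable_cong_sets[OF sets_P refl] affine_sample_def by measurable
  have "distr (PiM {..<n} (\<lambda>_. M 0 1)) (sample_space n) (affine_sample n a b) =
      PiM {..<n} (\<lambda>_. M a b)"
  proof (rule product_sigma_finite.PiM_eqI[OF sf])
    fix A :: "nat \<Rightarrow> real set"
    assume A: "\<And>i. i \<in> {..<n} \<Longrightarrow> A i \<in> sets (M a b)"
    then have A': "\<And>i. i \<in> {..<n} \<Longrightarrow> A i \<in> sets borel"
      by (simp add: sets_M)
    have pre: "affine_sample n a b -` Pi\<^sub>E {..<n} A \<inter> space (PiM {..<n} (\<lambda>_. M 0 1)) =
        Pi\<^sub>E {..<n} (\<lambda>i. {x. a + b * x \<in> A i})"
    proof (rule set_eqI)
      fix x :: "nat \<Rightarrow> real"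
      have "x \<in> affine_sample n a b -` Pi\<^sub>E {..<n} A \<inter> space (PiM {..<n} (\<lambda>_. M 0 1)) \<longleftrightarrow>
          (\<forall>i\<in>{..<n}. a + b * x i \<in> A i) \<and> x \<in> extensional {..<n}"
        unfolding Int_iff vimage_eq affine_sample_def restrict_PiE_iff
        by (simp add: space_PiM space_M PiE_UNIV_domain PiE_iff)
      also have "\<dots> \<longleftrightarrow> x \<in> Pi\<^sub>E {..<n} (\<lambda>i. {x. a + b * x \<in> A i})"
        by (simp only: PiE_iff mem_Collect_eq)
      finally show "x \<in> affine_sample n a b -` Pi\<^sub>E {..<n} A \<inter> space (PiM {..<n} (\<lambda>_. M 0 1)) \<longleftrightarrow>
          x \<in> Pi\<^sub>E {..<n} (\<lambda>i. {x. a + b * x \<in> A i})" .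
    qed
    have meas: "{x. a + b * x \<in> A i} \<in> sets (M 0 1)" if "i \<in> {..<n}" for i
    proof -
      have [measurable]: "A i \<in> sets borel"
        using A'[OF that] .
      show ?thesis
        unfolding sets_M by measurable
    qed
    have "emeasure (distr (PiM {..<n} (\<lambda>_. M 0 1)) (sample_space n) (affine_sample n a b)) (Pi\<^sub>E {..<n} A) =
        emeasure (PiM {..<n} (\<lambda>_. M 0 1)) (Pi\<^sub>E {..<n} (\<lambda>i. {x. a + b * x \<in> A i}))"
      using A' by (subst emeasure_distr[OF aff]) (auto simp: pre intro!: sets_PiM_I_finite)
    also have "\<dots> = (\<Prod>i<n. emeasure (M 0 1) {x. a + b * x \<in> A i})"
      by (rule product_sigma_finite.emeasure_PiM[OF sf]) (use meas in auto)
    also have "\<dots> = (\<Prod>i<n. emeasure (M a b) (A i))"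
      unfolding M_def by (intro prod.cong refl stable_distr_affine[OF b] A')
    finally show "emeasure (distr (PiM {..<n} (\<lambda>_. M 0 1)) (sample_space n) (affine_sample n a b))
        (Pi\<^sub>E {..<n} A) = (\<Prod>i<n. emeasure (M a b) (A i))" .
  qed (simp_all add: sets_P)
  then show ?thesis
    by (simp add: stable_sample_def M_def)
qed

text \<open>The probability of an invariant region does not depend on location and scale.\<close>

lemma stable_sample_invariant:
  assumes R: "invariant_region n R" and b: "b > 0"
  shows "measure (stable_sample n \<beta> a b \<theta>) R = measure (stable_sample n \<beta> 0 1 \<theta>) R"
proof -
  have sets_S: "sets (stable_sample n \<beta> 0 1 \<theta>) = sets (sample_space n)"
    unfolding stable_sample_def by (intro sets_PiM_cong) auto
  have space_S: "space (stable_sample n \<beta> 0 1 \<theta>) = space (sample_space n)"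
    by (rule sets_eq_imp_space_eq[OF sets_S])
  have aff: "affine_sample n a b \<in> measurable (stable_sample n \<beta> 0 1 \<theta>) (sample_space n)"
    unfolding measurable_cong_sets[OF sets_S refl] affine_sample_def by measurable
  have R_sets: "R \<in> sets (sample_space n)"
    using R by (simp add: invariant_region_def)
  have "affine_sample n a b -` R \<inter> space (stable_sample n \<beta> 0 1 \<theta>) = R"
    using R b sets.sets_into_space[OF R_sets]
    unfolding invariant_region_def space_S by blast
  then have "measure (distr (stable_sample n \<beta> 0 1 \<theta>) (sample_space n) (affine_sample n a b)) R =
      measure (stable_sample n \<beta> 0 1 \<theta>) R"
    by (simp add: measure_distr[OF aff R_sets])
  then show ?thesis
    by (simp add: stable_sample_affine[OF b])
qed

end

theory Submission
  imports Defs "HOL-Probability.Characteristic_Functions" "HOL-Probability.Sinc_Integral"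
begin

text \<open>
  Write \<open>l\<close> for the score of one observation and \<open>P\<^sub>\<theta>\<close> for the law of a sample with location 0 and
  scale 1; the power of an invariant region \<open>S\<close> is \<open>P\<^sub>\<theta>(S)\<close> for every location and scale. The theorem
  is the Neyman-Pearson lemma applied to the right derivative of this power at \<open>\<theta> = 0\<close>, combined
  with an average over the orbits of the affine group.

  The derivative is the integral of \<open>l(x\<^sub>1) + \<dots> + l(x\<^sub>n)\<close> over \<open>S\<close> with respect to \<open>P\<^sub>0\<close>
  (\<open>integral_joint_right_derivative\<close>). Pointwise differentiability of the density in \<open>\<theta>\<close> comes from
  the inversion integral by dominated convergence. To differentiate under the integral over the
  sample space, one needs an integrable bound that is uniform in \<open>\<theta>\<close>, namely
  \<open>\<bar>f(x;\<theta>) - f(x;0)\<bar> \<le> \<theta> C / (1 + x\<^sup>2)\<close> (\<open>std_density_diff_le\<close>). It is obtained by integrating by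
  parts twice in the inversion integral over \<open>t > 0\<close>: the boundary terms at \<open>0\<close> are purely imaginary
  and disappear in the real part, and the second derivative in \<open>t\<close> of the characteristic function,
  although it behaves like \<open>t powr (- \<theta>)\<close> near \<open>0\<close>, differs from its value at \<open>\<theta> = 0\<close> by at most
  \<open>\<theta>\<close> times an integrable function of \<open>t\<close> (\<open>theta_lip_half_cf''\<close>).

  For the average, let \<open>z(y)\<close> be the standardized sample. Tonelli's theorem and affine substitutions give
  \<open>K \<integral> H(x) dx = \<integral> exp(- \<Sum> y\<^sub>i\<^sup>2 / 4) \<integral>\<integral> H(a + b z(y)) b\<^bsup>n-2\<^esup> da db dy\<close>
  over \<open>b > 0\<close>, for every nonnegative \<open>H\<close> and one constant \<open>K\<close> (\<open>orbit_average\<close>). This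
  expresses that the sample is a random affine image of \<open>z\<close> without constructing coordinates on the
  orbit space. For an invariant \<open>S\<close> the indicator of \<open>S\<close> is constant on orbits, and the inner
  integral of the score is \<open>T(z)\<close>; hence \<open>K\<close> times the derivative of the power is the integral of
  \<open>T(z)\<close> over \<open>S\<close> with respect to \<open>P\<^sub>0\<close> (\<open>integral_invariant_score\<close>).

  Now compare \<open>R = {T > k}\<close> with an invariant region \<open>R'\<close> of no larger size. If the size of \<open>R'\<close> is
  smaller, continuity of the power at \<open>0\<close> suffices. If the sizes agree, then \<open>(1\<^sub>R - 1\<^sub>R\<^sub>') (T - k) \<ge> 0\<close>
  shows that the power of \<open>R\<close> has the strictly larger derivative, unless the two regions
  agree almost everywhere, in which case their powers coincide for all small \<open>\<theta>\<close>.
\<close>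

section \<open>Majorants on the half-line\<close>

text \<open>
  All factors of the second derivative of the characteristic function are bounded by polynomials in
  \<open>t - ln t\<close> times \<open>exp (\<theta> (t - ln t))\<close>: this one quantity controls both the logarithm at \<open>0\<close> and
  the polynomial growth at infinity.
\<close>

lemma log_gap_bounds:
  assumes "t > (0::real)"
  shows "t - ln t \<ge> 1" "\<bar>ln t\<bar> \<le> t - ln t" "t \<le> 2 * (t - ln t)"
proof -
  have 1: "ln t \<le> t - 1"
    using assms by (rule ln_le_minus_one)
  have "ln (t / 2) \<le> t / 2 - 1"
    using assms by (intro ln_le_minus_one) auto
  moreover have "ln (t / 2) = ln t - ln 2"
    using assms by (simp add: ln_div)
  moreover have "ln 2 \<le> (1::real)"
    using ln_le_minus_one[of "2::real"] by simp
  ultimately have 2: "2 * ln t \<le> t"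
    by simp
  show "t - ln t \<ge> 1"
    using 1 by simp
  show "\<bar>ln t\<bar> \<le> t - ln t"
    using 2 assms by (auto simp: abs_real_def)
  show "t \<le> 2 * (t - ln t)"
    using 2 by simp
qed

lemma cube_le_exp:
  assumes "y \<ge> (0::real)"
  shows "y ^ 3 \<le> 216000 * exp (y / 20)"
proof -
  have "y / 60 \<le> exp (y / 60)"
    using exp_ge_add_one_self[of "y / 60"] by linarith
  then have "(y / 60) ^ 3 \<le> exp (y / 60) ^ 3"
    using assms by (intro power_mono) auto
  also have "\<dots> = exp (y / 20)"
    by (simp flip: exp_of_nat_mult)
  finally show ?thesis
    by (simp add: power_divide)
qed

text \<open>
  The value is \<open>8 \<cdot> 60\<^sup>3\<close>, as needed in \<open>growth_dominates\<close>. It is hidden behind a constant so that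
  powers of it are not evaluated.
\<close>

definition growth_const :: real where
  "growth_const = 1728000"

lemma growth_const_ge: "growth_const \<ge> 1728000"
  by (simp add: growth_const_def)

definition growth :: "real \<Rightarrow> real" where
  "growth t = growth_const * exp ((t - ln t) / 10)"

lemma growth_ge:
  assumes "t > 0"
  shows "growth t \<ge> 1728000"
proof -
  have "1 * 1728000 \<le> exp ((t - ln t) / 10) * growth_const"
    using log_gap_bounds(1)[OF assms] growth_const_ge by (intro mult_mono) auto
  then show ?thesis
    by (simp add: growth_def mult.commute)
qed

text \<open>
  The cube and the factor \<open>exp (\<theta> y)\<close> each cost a factor \<open>exp (y / 20)\<close>, which together make up the
  exponential in \<open>growth\<close>.
\<close>

lemma growth_dominates:
  assumes "t > 0" "0 \<le> \<theta>" "\<theta> \<le> 1 / 20" "y = t - ln t"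
  shows "8 * y ^ 3 * exp (\<theta> * y) \<le> growth t"
proof -
  have y: "y \<ge> 1"
    using log_gap_bounds(1)[OF assms(1)] assms(4) by simp
  have "exp (\<theta> * y) \<le> exp (y / 20)"
    using assms y by (simp add: mult_right_mono)
  then have "y ^ 3 * exp (\<theta> * y) \<le> (216000 * exp (y / 20)) * exp (y / 20)"
    using y by (intro mult_mono cube_le_exp) auto
  also have "\<dots> = 216000 * exp (y / 10)"
    by (simp flip: exp_add)
  finally show ?thesis
    by (simp add: growth_def growth_const_def assms(4) mult_ac)
qed

text \<open>
  Five factors \<open>growth t\<close> contribute \<open>exp ((t - ln t) / 2)\<close>, so that against \<open>exp (- t)\<close> there remains
  a multiple of \<open>t powr (- 1 / 2) * exp (- t / 2)\<close>, a Gamma integrand (\<open>dominator_eq\<close>).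
\<close>

definition dominator :: "real \<Rightarrow> real" where
  "dominator t = growth t ^ 5 * exp (- t)"

lemma dominator_eq:
  assumes "t > 0"
  shows "dominator t = growth_const ^ 5 * (t powr (- 1 / 2) / exp (1 / 2 * t))"
proof -
  have "growth t ^ 5 * exp (- t) = growth_const ^ 5 * (exp ((t - ln t) / 10) ^ 5 * exp (- t))"
    unfolding growth_def power_mult_distrib by (simp only: mult.assoc)
  also have "exp ((t - ln t) / 10) ^ 5 * exp (- t) = exp (- 1 / 2 * ln t) * exp (- (1 / 2 * t))"
    unfolding exp_of_nat_mult[symmetric] exp_add[symmetric]
    by (rule arg_cong[where f = exp]) (simp add: field_simps)
  also have "\<dots> = t powr (- 1 / 2) / exp (1 / 2 * t)"
    using assms by (simp add: powr_def exp_minus field_simps)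
  finally show ?thesis
    unfolding dominator_def .
qed

lemma dominator_nonneg [simp]: "dominator t \<ge> 0"
  using growth_const_ge by (simp add: dominator_def growth_def)

lemma dominator_measurable [measurable]: "dominator \<in> borel_measurable borel"
  unfolding dominator_def growth_def by measurable

lemma dominator_integrable: "set_integrable lborel {0<..} dominator"
proof -
  have "(\<lambda>t. complex_of_real t powr (1 / 2 - 1) / of_real (exp (1 / 2 * t))) absolutely_integrable_on {0<..}"
    by (rule absolutely_integrable_Gamma_integral) auto
  then have "(\<lambda>t. norm (complex_of_real t powr (1 / 2 - 1) / of_real (exp (1 / 2 * t))))
      absolutely_integrable_on {0<..}"
    by (rule set_integrable_norm)
  then have "(\<lambda>t. growth_const ^ 5 * norm (complex_of_real t powr (1 / 2 - 1) / of_real (exp (1 / 2 * t))))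
      absolutely_integrable_on {0<..}"
    by (rule set_integrable_mult_right)
  also have "?this \<longleftrightarrow> dominator absolutely_integrable_on {0<..}"
    by (intro set_integrable_cong refl)
      (simp add: dominator_eq norm_divide norm_powr_real_powr)
  finally have "set_integrable lebesgue {0<..} dominator" .
  then show ?thesis
    unfolding set_integrable_def by (subst (asm) integrable_completion) auto
qed

lemma dominator_tendsto_0: "(dominator \<longlongrightarrow> 0) at_top"
proof -
  have "LIM t at_top. 1 / 2 * (t::real) :> at_top"
    by (intro filterlim_tendsto_pos_mult_at_top[OF tendsto_const] filterlim_ident) auto
  then have "((\<lambda>t. exp (- (1 / 2 * t))) \<longlongrightarrow> (0::real)) at_top"
    by (intro filterlim_compose[OF exp_at_bot] filterlim_uminus_at_bot[THEN iffD2]) simp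
  moreover have "((\<lambda>t. t powr (- 1 / 2)) \<longlongrightarrow> (0::real)) at_top"
    by (intro tendsto_neg_powr filterlim_ident) auto
  ultimately have "((\<lambda>t. growth_const ^ 5 * (t powr (- 1 / 2) * exp (- (1 / 2 * t))))
      \<longlongrightarrow> growth_const ^ 5 * (0 * 0)) at_top"
    by (intro tendsto_intros)
  then have "((\<lambda>t. growth_const ^ 5 * (t powr (- 1 / 2) * exp (- (1 / 2 * t)))) \<longlongrightarrow> 0) at_top"
    by simp
  then show ?thesis
    by (rule Lim_transform_eventually)
      (auto intro!: eventually_mono[OF eventually_gt_at_top[of 0]] simp: dominator_eq exp_minus field_simps)
qed

section \<open>Functions that are Lipschitz in the parameter at zero\<close>

text \<open>
  The same constant bounds the values and the Lipschitz quotients at \<open>\<theta> = 0\<close>. With this convention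
  the class is closed under products, so that a polynomial in several factors can be estimated
  factor by factor; the range \<open>\<theta> \<le> 1 / 20\<close> is the one in \<open>growth_dominates\<close>.
\<close>

definition theta_lip :: "real \<Rightarrow> (real \<Rightarrow> complex) \<Rightarrow> bool" where
  "theta_lip M f \<longleftrightarrow> (\<forall>\<theta>\<in>{0..1 / 20}. norm (f \<theta>) \<le> M \<and> norm (f \<theta> - f 0) \<le> M * \<theta>)"

lemma theta_lip_mono: "theta_lip M f \<Longrightarrow> M \<le> N \<Longrightarrow> theta_lip N f"
  unfolding theta_lip_def by (meson atLeastAtMost_iff mult_right_mono order_trans)

lemma theta_lip_const: "norm c \<le> M \<Longrightarrow> theta_lip M (\<lambda>_. c)"
  using order_trans[OF norm_ge_zero[of c]] by (simp add: theta_lip_def)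

lemma theta_lip_add:
  assumes "theta_lip M f" "theta_lip N g"
  shows "theta_lip (M + N) (\<lambda>\<theta>. f \<theta> + g \<theta>)"
  unfolding theta_lip_def
proof (intro ballI conjI)
  fix \<theta> :: real assume \<theta>: "\<theta> \<in> {0..1 / 20}"
  show "norm (f \<theta> + g \<theta>) \<le> M + N"
    using assms \<theta> unfolding theta_lip_def by (meson norm_triangle_mono)
  have "f \<theta> + g \<theta> - (f 0 + g 0) = (f \<theta> - f 0) + (g \<theta> - g 0)"
    by simp
  also have "norm \<dots> \<le> M * \<theta> + N * \<theta>"
    using assms \<theta> unfolding theta_lip_def by (meson norm_triangle_mono)
  finally show "norm (f \<theta> + g \<theta> - (f 0 + g 0)) \<le> (M + N) * \<theta>"
    by (simp add: algebra_simps)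
qed

lemma theta_lip_uminus: "theta_lip M f \<Longrightarrow> theta_lip M (\<lambda>\<theta>. - f \<theta>)"
  unfolding theta_lip_def by (simp only: minus_diff_minus norm_minus_cancel)

lemma theta_lip_diff:
  "theta_lip M f \<Longrightarrow> theta_lip N g \<Longrightarrow> theta_lip (M + N) (\<lambda>\<theta>. f \<theta> - g \<theta>)"
  using theta_lip_add[OF _ theta_lip_uminus] by simp

lemma theta_lip_mult:
  assumes "theta_lip M f" "theta_lip N g"
  shows "theta_lip (2 * M * N) (\<lambda>\<theta>. f \<theta> * g \<theta>)"
  unfolding theta_lip_def
proof (intro ballI conjI)
  fix \<theta> :: real assume \<theta>: "\<theta> \<in> {0..1 / 20}"
  have f: "norm (f \<theta>) \<le> M" "norm (f \<theta> - f 0) \<le> M * \<theta>"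
    and g: "norm (g \<theta>) \<le> N" "norm (g \<theta> - g 0) \<le> N * \<theta>" "norm (g 0) \<le> N"
    using assms \<theta> unfolding theta_lip_def by auto
  have "0 \<le> norm (f \<theta>)" "0 \<le> norm (g \<theta>)" by simp_all
  then have MN: "0 \<le> M" "0 \<le> N" using f g by linarith+
  have fg: "norm (f \<theta> * g \<theta>) \<le> M * N"
    unfolding norm_mult using f g MN by (intro mult_mono) auto
  also have "\<dots> \<le> 2 * M * N"
    using MN by simp
  finally show "norm (f \<theta> * g \<theta>) \<le> 2 * M * N" .
  (* the factor 2 in the constant comes from the two summands of the product rule *)
  have "f \<theta> * g \<theta> - f 0 * g 0 = f \<theta> * (g \<theta> - g 0) + (f \<theta> - f 0) * g 0"
    by (simp add: algebra_simps)
  also have "norm \<dots> \<le> M * (N * \<theta>) + (M * \<theta>) * N"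
    using f g MN \<theta> by (intro norm_triangle_mono) (auto simp: norm_mult intro!: mult_mono)
  finally show "norm (f \<theta> * g \<theta> - f 0 * g 0) \<le> 2 * M * N * \<theta>"
    by (simp add: algebra_simps)
qed

text \<open>
  The mean value inequality on the half-plane \<open>Re z \<le> M\<close>, where the derivative of \<open>exp\<close> is bounded by
  \<open>exp M\<close>.
\<close>

lemma norm_exp_diff_le:
  assumes "Re z \<le> M" "Re w \<le> M"
  shows "norm (exp z - exp w) \<le> exp M * norm (z - w)"
proof (rule field_differentiable_bound[where S = "{z. Re z \<le> M}" and f' = exp])
  show "convex {z. Re z \<le> M}"
    by (rule convex_halfspace_Re_le)
qed (use assms in \<open>auto intro!: derivative_eq_intros\<close>)

lemma theta_lip_exp:
  assumes f: "theta_lip M f" and M: "M \<ge> 1" and Re: "\<And>\<theta>. \<theta> \<in> {0..1 / 20} \<Longrightarrow> Re (f \<theta>) \<le> r"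
  shows "theta_lip (exp r * M) (\<lambda>\<theta>. exp (f \<theta>))"
  unfolding theta_lip_def
proof (intro ballI conjI)
  fix \<theta> :: real assume \<theta>: "\<theta> \<in> {0..1 / 20}"
  have "norm (exp (f \<theta>)) \<le> exp r * 1"
    using Re[OF \<theta>] by simp
  also have "\<dots> \<le> exp r * M"
    using M by simp
  finally show "norm (exp (f \<theta>)) \<le> exp r * M" .
  have "norm (exp (f \<theta>) - exp (f 0)) \<le> exp r * norm (f \<theta> - f 0)"
    by (intro norm_exp_diff_le Re \<theta>) auto
  also have "\<dots> \<le> exp r * (M * \<theta>)"
    using f \<theta> unfolding theta_lip_def by (intro mult_left_mono) auto
  finally show "norm (exp (f \<theta>) - exp (f 0)) \<le> exp r * M * \<theta>"
    by (simp add: mult.assoc)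
qed

lemma abs_exp_minus_one_le: "\<bar>exp x - 1\<bar> \<le> \<bar>x\<bar> * exp \<bar>x\<bar>" for x :: real
proof -
  have "norm (exp (of_real x) - exp (0::complex)) \<le> exp \<bar>x\<bar> * norm (of_real x - 0 :: complex)"
    by (rule norm_exp_diff_le) auto
  also have "exp (of_real x) - exp (0::complex) = of_real (exp x - 1)"
    by (simp add: exp_of_real)
  finally show ?thesis
    by (simp only: norm_of_real diff_zero mult.commute)
qed

text \<open>
  Since \<open>t powr (j - \<theta>) = t\<^sup>j exp (- \<theta> ln t)\<close>, the increment in \<open>\<theta>\<close> costs one further factor
  \<open>\<bar>ln t\<bar> \<le> t - ln t\<close>; with \<open>j \<le> 2\<close> this gives the cube in \<open>growth_dominates\<close>.
\<close>

lemma theta_lip_powr: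
  assumes t: "t > 0" and j: "j \<le> 2"
  shows "theta_lip (growth t) (\<lambda>\<theta>. of_real (t powr (real j - \<theta>)))"
  unfolding theta_lip_def
proof (intro ballI conjI)
  fix \<theta> :: real assume \<theta>: "\<theta> \<in> {0..1 / 20}"
  define y where "y = t - ln t"
  note y = log_gap_bounds[OF t, folded y_def]
  have p: "t powr (real j - \<theta>) = t ^ j * exp (- (\<theta> * ln t))"
    using t by (simp add: powr_diff powr_realpow powr_def[of t \<theta>] exp_minus divide_simps)
  have p0: "t powr (real j - 0) = t ^ j"
    using t by (simp add: powr_realpow)
  have "t ^ j \<le> (2 * y) ^ j"
    using y t by (intro power_mono) auto
  also have "\<dots> \<le> (2 * y) ^ 2"
    using y j by (intro power_increasing) auto
  finally have tj: "t ^ j \<le> (2 * y) ^ 2" .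
  have \<theta>y: "\<bar>\<theta> * ln t\<bar> \<le> \<theta> * y"
    using y \<theta> by (simp add: abs_mult mult_left_mono)
  have dom: "8 * y ^ 3 * exp (\<theta> * y) \<le> growth t"
    using \<theta> t by (intro growth_dominates) (auto simp: y_def)
  have "(2 * y) ^ 2 * y \<le> 8 * y ^ 3"
    using y by (simp add: power2_eq_square power3_eq_cube)
  then have dom': "(2 * y) ^ 2 * y * exp (\<theta> * y) \<le> growth t"
    using dom by (smt (verit) exp_gt_zero mult_right_mono)
  have "norm (complex_of_real (t powr (real j - \<theta>))) = t ^ j * exp (- (\<theta> * ln t))"
    unfolding p norm_of_real using t by (simp add: abs_mult)
  also have "\<dots> \<le> (2 * y) ^ 2 * exp (\<theta> * y)"
    using \<theta>y tj by (intro mult_mono) auto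
  also have "\<dots> \<le> (2 * y) ^ 2 * y * exp (\<theta> * y)"
    using y by (intro mult_right_mono) auto
  finally show "norm (complex_of_real (t powr (real j - \<theta>))) \<le> growth t"
    using dom' by linarith
  have "norm (complex_of_real (t powr (real j - \<theta>)) - complex_of_real (t powr (real j - 0))) =
      \<bar>t powr (real j - \<theta>) - t powr (real j - 0)\<bar>"
    by (simp only: norm_of_real flip: of_real_diff)
  also have "\<dots> = t ^ j * \<bar>exp (- (\<theta> * ln t)) - 1\<bar>"
  proof -
    have "t powr (real j - \<theta>) - t powr (real j - 0) = t ^ j * (exp (- (\<theta> * ln t)) - 1)"
      unfolding p p0 by (simp add: algebra_simps)
    then show ?thesis
      using t by (simp add: abs_mult)
  qed
  also have "\<dots> \<le> (2 * y) ^ 2 * ((\<theta> * y) * exp (\<theta> * y))"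
  proof (intro mult_mono tj)
    have "\<bar>exp (- (\<theta> * ln t)) - 1\<bar> \<le> \<bar>\<theta> * ln t\<bar> * exp \<bar>\<theta> * ln t\<bar>"
      using abs_exp_minus_one_le[of "- (\<theta> * ln t)"] by simp
    also have "\<dots> \<le> (\<theta> * y) * exp (\<theta> * y)"
      using \<theta>y by (intro mult_mono) (auto intro: order_trans[OF abs_ge_zero])
    finally show "\<bar>exp (- (\<theta> * ln t)) - 1\<bar> \<le> (\<theta> * y) * exp (\<theta> * y)" .
  qed auto
  also have "\<dots> \<le> growth t * \<theta>"
    using mult_right_mono[OF dom', of \<theta>] \<theta> by (simp add: mult_ac)
  finally show "norm (complex_of_real (t powr (real j - \<theta>)) - complex_of_real (t powr (real j - 0)))
      \<le> growth t * \<theta>" .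
qed

lemma tan_bounds:
  assumes "0 \<le> \<theta>" "\<theta> \<le> 1 / 20"
  shows "0 \<le> tan (pi * \<theta> / 2)" "tan (pi * \<theta> / 2) \<le> 4 * \<theta>"
proof -
  define u where "u = pi * \<theta> / 2"
  have u: "0 \<le> u" "u \<le> 2 * \<theta>" "u < pi / 3"
  proof -
    have "pi * \<theta> \<le> 4 * \<theta>" "0 \<le> pi * \<theta>"
      using assms pi_less_4 by (intro mult_right_mono mult_nonneg_nonneg; simp)+
    then show "0 \<le> u" "u \<le> 2 * \<theta>" "u < pi / 3"
      using assms pi_gt3 by (simp_all add: u_def)
  qed
  have "cos (pi / 3) \<le> cos u"
    using u pi_gt_zero by (intro cos_monotone_0_pi_le) auto
  then have c: "cos u \<ge> 1 / 2"
    by (simp add: cos_60)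
  have "sin u \<le> u"
    using u by (intro sin_x_le_x)
  then have "tan u \<le> u / (1/2)"
    unfolding tan_def using c u by (intro frac_le) auto
  then show "tan (pi * \<theta> / 2) \<le> 4 * \<theta>"
    using u by (simp add: u_def)
  have "0 \<le> sin u"
    using u pi_gt_zero by (intro sin_ge_zero) auto
  then show "0 \<le> tan (pi * \<theta> / 2)"
    using c unfolding tan_def u_def by auto
qed

section \<open>The characteristic function on the half-line\<close>

text \<open>
  For \<open>t > 0\<close> and \<open>\<alpha> = 2 - \<theta>\<close> the product \<open>t powr \<alpha> * t powr (1 - \<alpha>)\<close> is \<open>t\<close>, and \<open>tan (pi \<alpha> / 2) = - tan (pi \<theta> / 2)\<close>. Hence
  the exponent of the characteristic function is the sum of an imaginary linear term and a multiple
  of \<open>t powr (2 - \<theta>)\<close> (\<open>stable_cf_pos\<close>); this is the form that can be differentiated in \<open>t\<close>.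
\<close>

definition skew :: "real \<Rightarrow> real \<Rightarrow> complex" where
  "skew \<beta> \<theta> = \<i> * of_real (\<beta> * tan (pi * \<theta> / 2))"

definition half_exponent :: "real \<Rightarrow> real \<Rightarrow> real \<Rightarrow> complex" where
  "half_exponent \<beta> \<theta> t = skew \<beta> \<theta> * of_real t - (1 + skew \<beta> \<theta>) * of_real (t powr (2 - \<theta>))"

definition half_cf :: "real \<Rightarrow> real \<Rightarrow> real \<Rightarrow> complex" where
  "half_cf \<beta> \<theta> t = exp (half_exponent \<beta> \<theta> t)"

definition half_exponent' :: "real \<Rightarrow> real \<Rightarrow> real \<Rightarrow> complex" where
  "half_exponent' \<beta> \<theta> t =
     skew \<beta> \<theta> - (1 + skew \<beta> \<theta>) * of_real (2 - \<theta>) * of_real (t powr (1 - \<theta>))"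

definition half_exponent'' :: "real \<Rightarrow> real \<Rightarrow> real \<Rightarrow> complex" where
  "half_exponent'' \<beta> \<theta> t =
     - ((1 + skew \<beta> \<theta>) * (of_real (2 - \<theta>) * of_real (1 - \<theta>)) * of_real (t powr (0 - \<theta>)))"

definition half_cf' :: "real \<Rightarrow> real \<Rightarrow> real \<Rightarrow> complex" where
  "half_cf' \<beta> \<theta> t = half_exponent' \<beta> \<theta> t * half_cf \<beta> \<theta> t"

definition half_cf'' :: "real \<Rightarrow> real \<Rightarrow> real \<Rightarrow> complex" where
  "half_cf'' \<beta> \<theta> t = (half_exponent'' \<beta> \<theta> t + half_exponent' \<beta> \<theta> t * half_exponent' \<beta> \<theta> t) * half_cf \<beta> \<theta> t"

lemma stable_cf_pos:
  assumes "t > 0"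
  shows "stable_cf t (2 - \<theta>) \<beta> = half_cf \<beta> \<theta> t"
proof -
  have "pi * (2 - \<theta>) / 2 = - (pi * \<theta> / 2) + pi"
    by (simp add: field_simps)
  then have tan: "tan (pi * (2 - \<theta>) / 2) = - tan (pi * \<theta> / 2)"
    by (simp only: tan_periodic_pi tan_minus)
  have "t powr (2 - \<theta>) * t powr (1 - (2 - \<theta>)) = t"
    using assms by (simp flip: powr_add)
  then have t: "complex_of_real (t powr (2 - \<theta>)) * of_real (t powr (1 - (2 - \<theta>))) = of_real t"
    by (simp only: flip: of_real_mult)
  have "- complex_of_real (\<bar>t\<bar> powr (2 - \<theta>)) *
      (1 + \<i> * complex_of_real (\<beta> * sgn t * tan (pi * (2 - \<theta>) / 2) * (\<bar>t\<bar> powr (1 - (2 - \<theta>)) - 1))) =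
    skew \<beta> \<theta> * (complex_of_real (t powr (2 - \<theta>)) * of_real (t powr (1 - (2 - \<theta>))))
      - (1 + skew \<beta> \<theta>) * of_real (t powr (2 - \<theta>))"
    using assms unfolding skew_def tan by (simp add: algebra_simps)
  then show ?thesis
    unfolding stable_cf_def half_cf_def half_exponent_def t by simp
qed

lemma stable_cf_uminus: "stable_cf (- t) \<alpha> \<beta> = cnj (stable_cf t \<alpha> \<beta>)"
  unfolding stable_cf_def by (simp add: exp_cnj sgn_minus)

lemma stable_cf_0 [simp]: "stable_cf 0 \<alpha> \<beta> = 1"
  by (simp add: stable_cf_def)

lemma half_cf_has_vector_derivative:
  assumes t: "t > 0"
  shows "(half_cf \<beta> \<theta> has_vector_derivative half_cf' \<beta> \<theta> t) (at t)"
proof -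
  have p: "((\<lambda>t. complex_of_real (t powr (2 - \<theta>))) has_vector_derivative
      of_real ((2 - \<theta>) * t powr (1 - \<theta>))) (at t)"
    using has_vector_derivative_of_real[OF has_real_derivative_powr[OF t, of "2 - \<theta>"]] by simp
  have "(half_exponent \<beta> \<theta> has_vector_derivative half_exponent' \<beta> \<theta> t) (at t)"
    unfolding half_exponent_def half_exponent'_def
    by (rule derivative_eq_intros p refl)+ (simp add: mult.assoc)
  from field_vector_diff_chain_at[OF this DERIV_exp] show ?thesis
    by (simp add: o_def half_cf_def[abs_def] half_cf'_def)
qed

lemma half_cf'_has_vector_derivative:
  assumes t: "t > 0"
  shows "(half_cf' \<beta> \<theta> has_vector_derivative half_cf'' \<beta> \<theta> t) (at t)"
proof -
  have p: "((\<lambda>t. complex_of_real (t powr (1 - \<theta>))) has_vector_derivative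
      of_real ((1 - \<theta>) * t powr (0 - \<theta>))) (at t)"
    using has_vector_derivative_of_real[OF has_real_derivative_powr[OF t, of "1 - \<theta>"]] by simp
  have "(half_exponent' \<beta> \<theta> has_vector_derivative half_exponent'' \<beta> \<theta> t) (at t)"
    unfolding half_exponent''_def half_exponent'_def
    by (rule derivative_eq_intros p refl)+ (simp add: mult.assoc)
  from has_vector_derivative_mult[OF this half_cf_has_vector_derivative[OF t]] show ?thesis
    by (simp add: half_cf'_def[abs_def] half_cf''_def algebra_simps)
qed

lemma theta_lip_skew:
  assumes "\<bar>\<beta>\<bar> \<le> 1"
  shows "theta_lip 4 (skew \<beta>)"
  unfolding theta_lip_def
proof (intro ballI)
  fix \<theta> :: real assume \<theta>: "\<theta> \<in> {0..1/20}"
  have "norm (skew \<beta> \<theta>) = \<bar>\<beta>\<bar> * \<bar>tan (pi * \<theta> / 2)\<bar>"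
    by (simp add: skew_def norm_mult abs_mult)
  also have "\<dots> \<le> 1 * (4 * \<theta>)"
    using tan_bounds[of \<theta>] \<theta> assms by (intro mult_mono) auto
  finally have "norm (skew \<beta> \<theta>) \<le> 4 * \<theta>"
    by simp
  then show "norm (skew \<beta> \<theta>) \<le> 4 \<and> norm (skew \<beta> \<theta> - skew \<beta> 0) \<le> 4 * \<theta>"
    using \<theta> by (auto simp: skew_def)
qed

lemma theta_lip_of_real_diff:
  assumes "1 \<le> c"
  shows "theta_lip c (\<lambda>\<theta>. of_real (c - \<theta>))"
  unfolding theta_lip_def
proof (intro ballI)
  fix \<theta> :: real assume \<theta>: "\<theta> \<in> {0..1/20}"
  then have "\<theta> \<le> c * \<theta>"
    using assms by (simp add: mult_le_cancel_right1)
  moreover have "complex_of_real (c - \<theta>) - of_real (c - 0) = of_real (- \<theta>)"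
    by simp
  ultimately show "norm (complex_of_real (c - \<theta>)) \<le> c \<and>
      norm (complex_of_real (c - \<theta>) - of_real (c - 0)) \<le> c * \<theta>"
    using \<theta> assms by (simp only: norm_of_real) auto
qed

context
  fixes \<beta> t :: real
  assumes \<beta>: "\<bar>\<beta>\<bar> \<le> 1" and t: "t > 0"
begin

lemma theta_lip_one_plus_skew: "theta_lip 5 (\<lambda>\<theta>. 1 + skew \<beta> \<theta>)"
  using theta_lip_add[OF theta_lip_const[of 1 1] theta_lip_skew[OF \<beta>]] by simp

lemma theta_lip_half_exponent': "theta_lip (4 + 40 * growth t) (\<lambda>\<theta>. half_exponent' \<beta> \<theta> t)"
  unfolding half_exponent'_def
  using theta_lip_diff[OF theta_lip_skew[OF \<beta>] theta_lip_mult[OF theta_lip_mult[OF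
    theta_lip_one_plus_skew theta_lip_of_real_diff[of 2]] theta_lip_powr[OF t, of 1]]] by simp

lemma theta_lip_half_exponent'': "theta_lip (80 * growth t) (\<lambda>\<theta>. half_exponent'' \<beta> \<theta> t)"
  unfolding half_exponent''_def
  using theta_lip_uminus[OF theta_lip_mult[OF theta_lip_mult[OF
    theta_lip_one_plus_skew theta_lip_mult[OF theta_lip_of_real_diff[of 2] theta_lip_of_real_diff[of 1]]]
    theta_lip_powr[OF t, of 0]]] by simp

lemma theta_lip_half_exponent: "theta_lip (18 * growth t) (\<lambda>\<theta>. half_exponent \<beta> \<theta> t)"
proof -
  have "t \<le> growth t"
    using theta_lip_powr[OF t, of 1] t unfolding theta_lip_def by (auto dest!: bspec[of _ _ 0])
  then have "theta_lip (growth t) (\<lambda>_. complex_of_real t)"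
    using t by (intro theta_lip_const) auto
  from theta_lip_diff[OF theta_lip_mult[OF theta_lip_skew[OF \<beta>] this]
      theta_lip_mult[OF theta_lip_one_plus_skew theta_lip_powr[OF t, of 2]]]
  show ?thesis
    unfolding half_exponent_def by simp
qed

text \<open>
  Uniform exponential decay in \<open>t\<close>: the real part is \<open>- t powr (2 - \<theta>)\<close>, and the exponent \<open>2 - \<theta>\<close> is at least 1.
\<close>

lemma Re_half_exponent_le:
  assumes "\<theta> \<in> {0..1/20}"
  shows "Re (half_exponent \<beta> \<theta> t) \<le> 1 - t"
proof -
  have "t - 1 \<le> t powr (2 - \<theta>)"
  proof (cases "t \<ge> 1")
    case True
    then have "t powr 1 \<le> t powr (2 - \<theta>)"
      using assms by (intro powr_mono) auto
    then show ?thesis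
      using t by simp
  next
    case False
    then show ?thesis
      using powr_ge_zero[of t "2 - \<theta>"] by linarith
  qed
  then show ?thesis
    by (simp add: half_exponent_def skew_def)
qed

lemma theta_lip_half_cf: "theta_lip (exp (1 - t) * (18 * growth t)) (\<lambda>\<theta>. half_cf \<beta> \<theta> t)"
  unfolding half_cf_def
  by (intro theta_lip_exp theta_lip_half_exponent Re_half_exponent_le) (use growth_ge[OF t] in auto)

lemma exp_one_minus_le: "exp (1 - t) \<le> 3 * exp (- t)"
  using exp_le by (simp add: exp_diff exp_minus divide_simps)

lemma theta_lip_cf_dominator: "theta_lip (dominator t) (\<lambda>\<theta>. half_cf \<beta> \<theta> t)"
proof (rule theta_lip_mono[OF theta_lip_half_cf])
  have "exp (1 - t) * (18 * growth t) \<le> (3 * exp (- t)) * (18 * growth t)"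
    using growth_ge[OF t] by (intro mult_right_mono exp_one_minus_le) auto
  also have "\<dots> = 54 * growth t ^ 1 * exp (- t)"
    by simp
  also have "54 * growth t ^ 1 \<le> growth t * growth t ^ 4"
    using growth_ge[OF t] by (intro mult_mono power_increasing) auto
  also have "growth t * growth t ^ 4 = growth t ^ 5"
    by (simp add: eval_nat_numeral)
  finally show "exp (1 - t) * (18 * growth t) \<le> dominator t"
    unfolding dominator_def by simp
qed

text \<open>
  The logarithmic singularity of the \<open>\<theta>\<close>-derivative at \<open>t = 0\<close> is absorbed by the integrable
  singularity of the dominator.
\<close>

lemma theta_lip_half_cf'':
  "theta_lip (dominator t) (\<lambda>\<theta>. half_cf'' \<beta> \<theta> t)"
proof -
  (* a factor of g beats every numerical constant below 1728000, which absorbs all coefficients *)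
  define g where "g = growth t"
  have g: "g \<ge> 1728000"
    unfolding g_def by (rule growth_ge[OF t])
  have "80 * g + 2 * (4 + 40 * g) * (4 + 40 * g) \<le> 80 * g ^ 2 + 2 * (41 * g) * (41 * g)"
    using g by (intro add_mono mult_mono) (auto simp: power2_eq_square)
  also have "\<dots> = 3442 * g ^ 2"
    by (simp add: power2_eq_square)
  finally have poly: "80 * g + 2 * (4 + 40 * g) * (4 + 40 * g) \<le> 3442 * g ^ 2" .
  have "theta_lip (2 * (80 * g + 2 * (4 + 40 * g) * (4 + 40 * g)) * (exp (1 - t) * (18 * g)))
      (\<lambda>\<theta>. half_cf'' \<beta> \<theta> t)"
    unfolding half_cf''_def g_def
    by (intro theta_lip_mult theta_lip_add theta_lip_half_exponent'' theta_lip_half_exponent' theta_lip_half_cf)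
  then show ?thesis
  proof (rule theta_lip_mono)
    have "2 * (80 * g + 2 * (4 + 40 * g) * (4 + 40 * g)) * (exp (1 - t) * (18 * g)) \<le>
        2 * (3442 * g ^ 2) * ((3 * exp (- t)) * (18 * g))"
      using g by (intro mult_mono poly exp_one_minus_le) auto
    also have "\<dots> = 371736 * g ^ 3 * exp (- t)"
      by (simp add: eval_nat_numeral)
    also have "371736 * g ^ 3 \<le> g * g ^ 4"
      using g by (intro mult_mono power_increasing) auto
    also have "g * g ^ 4 = g ^ 5"
      by (simp add: eval_nat_numeral)
    finally show "2 * (80 * g + 2 * (4 + 40 * g) * (4 + 40 * g)) * (exp (1 - t) * (18 * g)) \<le> dominator t"
      by (simp add: dominator_def g_def)
  qed
qed

lemma norm_half_cf'_le:
  assumes "\<theta> \<in> {0..1/20}"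
  shows "norm (half_cf' \<beta> \<theta> t) \<le> dominator t"
proof -
  define g where "g = growth t"
  have g: "g \<ge> 1728000"
    unfolding g_def by (rule growth_ge[OF t])
  have "norm (half_cf' \<beta> \<theta> t) \<le> (4 + 40 * g) * (exp (1 - t) * (18 * g))"
    using theta_lip_half_exponent' theta_lip_half_cf assms g
    unfolding half_cf'_def norm_mult theta_lip_def g_def by (intro mult_mono) auto
  also have "\<dots> \<le> (41 * g) * ((3 * exp (- t)) * (18 * g))"
    using g by (intro mult_mono exp_one_minus_le) auto
  also have "\<dots> = 2214 * g ^ 2 * exp (- t)"
    by (simp add: eval_nat_numeral)
  also have "2214 * g ^ 2 \<le> g * g ^ 4"
    using g by (intro mult_mono power_increasing) auto
  also have "g * g ^ 4 = g ^ 5"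
    by (simp add: eval_nat_numeral)
  finally show ?thesis
    by (simp add: dominator_def g_def)
qed

end

lemma set_integrable_fourier:
  fixes h :: "real \<Rightarrow> complex"
  assumes "set_integrable lborel A h"
  shows "set_integrable lborel A (\<lambda>t. exp (- \<i> * of_real t * of_real x) * h t)"
proof -
  have "integrable lborel (\<lambda>t. exp (- \<i> * of_real t * of_real x) * (indicator A t *\<^sub>R h t))"
  proof (rule Bochner_Integration.integrable_bound)
    show "integrable lborel (\<lambda>t. indicator A t *\<^sub>R h t)"
      using assms by (simp add: set_integrable_def)
    then have [measurable]: "(\<lambda>t. indicator A t *\<^sub>R h t) \<in> borel_measurable borel"
      by auto
    show "(\<lambda>t. exp (- \<i> * of_real t * of_real x) * (indicator A t *\<^sub>R h t)) \<in> borel_measurable lborel"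
      by measurable
  qed (simp add: norm_mult)
  then show ?thesis
    by (simp add: set_integrable_def mult_scaleR_right)
qed

section \<open>Integration by parts in the inversion integral\<close>

text \<open>
  Both integrations by parts are done at once, because
  \<open>exp (- \<i> t x) (h' + \<i> x h)\<close> is an antiderivative of \<open>exp (- \<i> t x) (x\<^sup>2 h + h'')\<close>. The formula also
  holds at \<open>x = 0\<close>.
\<close>

lemma fourier_half_line_by_parts:
  fixes h h' h'' :: "real \<Rightarrow> complex" and x :: real
  assumes h: "\<And>t. t > 0 \<Longrightarrow> (h has_vector_derivative h' t) (at t)"
    and h': "\<And>t. t > 0 \<Longrightarrow> (h' has_vector_derivative h'' t) (at t)"
    and h'': "\<And>t. t > 0 \<Longrightarrow> isCont h'' t"
    and int: "set_integrable lborel {0<..} h" "set_integrable lborel {0<..} h''"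
    and at_0: "(h \<longlongrightarrow> A) (at_right 0)" "(h' \<longlongrightarrow> B) (at_right 0)"
    and at_infty: "(h \<longlongrightarrow> 0) at_top" "(h' \<longlongrightarrow> 0) at_top"
  shows "of_real (x\<^sup>2) * (CLINT t:{0<..}|lborel. exp (- \<i> * of_real t * of_real x) * h t) =
     - (B + \<i> * of_real x * A) - (CLINT t:{0<..}|lborel. exp (- \<i> * of_real t * of_real x) * h'' t)"
proof -
  define e where "e t = exp (- \<i> * of_real t * of_real x)" for t :: real
  define F where "F t = e t * (h' t + \<i> * of_real x * h t)" for t
  define f where "f t = of_real (x\<^sup>2) * (e t * h t) + e t * h'' t" for t
  have e: "(e has_vector_derivative - \<i> * of_real x * e t) (at t)" for t
  proof -
    have "((\<lambda>t. - \<i> * of_real t * of_real x) has_vector_derivative (- \<i> * of_real x)) (at t)"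
      by (auto intro!: derivative_eq_intros)
    from field_vector_diff_chain_at[OF this DERIV_exp] show ?thesis
      by (simp add: o_def e_def[abs_def])
  qed
  have F: "(F has_vector_derivative f t) (at t)" if "t > 0" for t
    unfolding F_def f_def
    by (rule derivative_eq_intros refl e h h' that)+ (simp add: algebra_simps power2_eq_square)
  have cont: "isCont f t" if "t > 0" for t
    unfolding f_def
    by (intro continuous_intros has_vector_derivative_continuous[OF e]
        has_vector_derivative_continuous[OF h] h'' that)
  have int1: "set_integrable lborel {0<..} (\<lambda>t. of_real (x\<^sup>2) * (e t * h t))"
    unfolding e_def by (intro set_integrable_mult_right set_integrable_fourier int)
  have int2: "set_integrable lborel {0<..} (\<lambda>t. e t * h'' t)"
    unfolding e_def by (intro set_integrable_fourier int)
  have intf: "set_integrable lborel {0<..} f"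
    unfolding f_def by (rule set_integral_add(1)[OF int1 int2])
  have norm_e: "norm (e t) = 1" for t
    by (simp add: e_def)
  have "(F \<longlongrightarrow> 1 * (B + \<i> * of_real x * A)) (at_right 0)"
  proof -
    have "(e \<longlongrightarrow> e 0) (at_right 0)"
      using has_vector_derivative_continuous[OF e[of 0]]
      by (simp add: continuous_within tendsto_within_subset[of _ _ _ UNIV])
    then have "(e \<longlongrightarrow> 1) (at_right 0)"
      by (simp add: e_def)
    then show ?thesis
      unfolding F_def by (intro tendsto_intros at_0)
  qed
  moreover have "(F \<longlongrightarrow> 0) at_top"
  proof -
    have "((\<lambda>t. h' t + \<i> * of_real x * h t) \<longlongrightarrow> 0 + \<i> * of_real x * 0) at_top"
      by (intro tendsto_intros at_infty)
    then have "((\<lambda>t. norm (h' t + \<i> * of_real x * h t)) \<longlongrightarrow> 0) at_top"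
      by (simp add: tendsto_norm_zero)
    then show ?thesis
      by (intro tendsto_norm_zero_cancel[of F]) (simp add: F_def norm_mult norm_e)
  qed
  ultimately have "(LBINT t=0..\<infinity>. f t) = 0 - 1 * (B + \<i> * of_real x * A)"
    by (intro interval_integral_FTC_integrable[where F = F])
      (use F cont intf in \<open>auto simp: ereal_tendsto_simps zero_ereal_def einterval_eq\<close>)
  then have "(CLINT t:{0<..}|lborel. f t) = - (B + \<i> * of_real x * A)"
    by (simp add: interval_lebesgue_integral_0_infty)
  moreover have "(CLINT t:{0<..}|lborel. f t) =
      of_real (x\<^sup>2) * (CLINT t:{0<..}|lborel. e t * h t) + (CLINT t:{0<..}|lborel. e t * h'' t)"
    unfolding f_def using set_integral_add(2)[OF int1 int2] by simp
  ultimately show ?thesis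
    by (simp add: e_def algebra_simps)
qed

section \<open>The density near the normal law\<close>

lemma integrable_dominator_abs: "integrable lborel (\<lambda>t. dominator \<bar>t\<bar>)"
proof -
  have "integrable lborel (\<lambda>t. indicator {0<..} t *\<^sub>R dominator t)"
    using dominator_integrable by (simp add: set_integrable_def)
  then obtain r where "has_bochner_integral lborel (\<lambda>t. indicator {0<..} t *\<^sub>R dominator t) r"
    using has_bochner_integral_integrable by blast
  then have "has_bochner_integral lborel (\<lambda>t. indicator {0..} t *\<^sub>R dominator \<bar>t\<bar>) r"
    by (rule has_bochner_integral_discrete_difference[where X = "{0}", THEN iffD1, rotated 4])
      (auto simp: indicator_def)
  then have "has_bochner_integral lborel (\<lambda>t. dominator \<bar>t\<bar>) (2 *\<^sub>R r)"
    by (rule has_bochner_integral_even_function) simp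
  then show ?thesis
    by (rule integrable.intros)
qed

text \<open>
  The value at \<open>0\<close> is determined by the convention \<open>ln 0 = 0\<close>; being at least 1, it bounds the
  characteristic function there too, so the bounds below hold at every \<open>t\<close>.
\<close>

lemma dominator_0: "1 \<le> dominator 0"
proof -
  have "1 \<le> growth_const ^ 5"
    using growth_const_ge by (intro one_le_power) simp
  then show ?thesis
    by (simp add: dominator_def growth_def)
qed

lemma stable_cf_measurable [measurable]: "(\<lambda>t. stable_cf t \<alpha> \<beta>) \<in> borel_measurable borel"
  unfolding stable_cf_def by measurable

lemma
  assumes "\<bar>\<beta>\<bar> \<le> 1" "\<theta> \<in> {0..1/20}"
  shows norm_stable_cf_le: "norm (stable_cf t (2 - \<theta>) \<beta>) \<le> dominator \<bar>t\<bar>" (is ?A)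
    and norm_stable_cf_diff_le:
      "norm (stable_cf t (2 - \<theta>) \<beta> - stable_cf t 2 \<beta>) \<le> dominator \<bar>t\<bar> * \<theta>" (is ?B)
proof -
  have pos: "norm (stable_cf t (2 - \<theta>) \<beta>) \<le> dominator t \<and>
      norm (stable_cf t (2 - \<theta>) \<beta> - stable_cf t 2 \<beta>) \<le> dominator t * \<theta>" if "t > 0" for t
    using theta_lip_cf_dominator[OF assms(1) that] assms(2)
      stable_cf_pos[OF that, of \<theta> \<beta>] stable_cf_pos[OF that, of 0 \<beta>]
    unfolding theta_lip_def by simp
  have "?A \<and> ?B"
  proof (cases t "0::real" rule: linorder_cases)
    case greater
    then show ?thesis
      using pos[of t] by simp
  next
    case equal
    then show ?thesis
      using dominator_0 assms(2) by (simp add: mult_nonneg_nonneg)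
  next
    case less
    have "stable_cf t \<alpha> \<beta> = cnj (stable_cf (- t) \<alpha> \<beta>)" for \<alpha>
      using stable_cf_uminus[of "- t" \<alpha> \<beta>] by simp
    then show ?thesis
      using pos[of "- t"] less by (simp flip: complex_cnj_diff)
  qed
  then show ?A ?B by auto
qed

lemma
  assumes "\<bar>\<beta>\<bar> \<le> 1" "\<theta> \<in> {0..1/20}"
  shows integrable_fourier_stable_cf:
      "integrable lborel (\<lambda>t. exp (- \<i> * of_real t * of_real x) * stable_cf t (2 - \<theta>) \<beta>)"
    and integrable_half_cf: "set_integrable lborel {0<..} (half_cf \<beta> \<theta>)"
    and integrable_half_cf'': "set_integrable lborel {0<..} (half_cf'' \<beta> \<theta>)"
proof -
  show "integrable lborel (\<lambda>t. exp (- \<i> * of_real t * of_real x) * stable_cf t (2 - \<theta>) \<beta>)"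
    by (rule Bochner_Integration.integrable_bound[OF integrable_dominator_abs])
      (use norm_stable_cf_le[OF assms] in \<open>auto simp: norm_mult\<close>)
  show "set_integrable lborel {0<..} (half_cf \<beta> \<theta>)"
    unfolding set_integrable_def
  proof (rule Bochner_Integration.integrable_bound)
    show "integrable lborel (\<lambda>t. indicator {0<..} t *\<^sub>R dominator t)"
      using dominator_integrable by (simp add: set_integrable_def)
    show "(\<lambda>t. indicator {0<..} t *\<^sub>R half_cf \<beta> \<theta> t) \<in> borel_measurable lborel"
      unfolding half_cf_def half_exponent_def by measurable
    show "AE t in lborel. norm (indicator {0<..} t *\<^sub>R half_cf \<beta> \<theta> t) \<le>
        norm (indicator {0<..} t *\<^sub>R dominator t)"
      using theta_lip_cf_dominator[OF assms(1)] assms(2)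
      unfolding theta_lip_def by (auto simp: indicator_def)
  qed
  show "set_integrable lborel {0<..} (half_cf'' \<beta> \<theta>)"
    unfolding set_integrable_def
  proof (rule Bochner_Integration.integrable_bound)
    show "integrable lborel (\<lambda>t. indicator {0<..} t *\<^sub>R dominator t)"
      using dominator_integrable by (simp add: set_integrable_def)
    show "(\<lambda>t. indicator {0<..} t *\<^sub>R half_cf'' \<beta> \<theta> t) \<in> borel_measurable lborel"
      unfolding half_cf''_def half_exponent'_def half_exponent''_def half_cf_def half_exponent_def
      by measurable
    show "AE t in lborel. norm (indicator {0<..} t *\<^sub>R half_cf'' \<beta> \<theta> t) \<le>
        norm (indicator {0<..} t *\<^sub>R dominator t)"
      using theta_lip_half_cf''[OF assms(1)] assms(2)
      unfolding theta_lip_def by (auto simp: indicator_def)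
  qed
qed

lemma Re_inversion_factor: "Re (1 / (2 * complex_of_real pi) * z) = 1 / (2 * pi) * Re z"
proof -
  have "1 / (2 * complex_of_real pi) * z = complex_of_real (1 / (2 * pi)) * z"
    by simp
  then show ?thesis
    by (simp only: times_complex.sel Re_complex_of_real Im_complex_of_real mult_zero_left diff_zero)
qed

text \<open>
  At \<open>- t\<close> the integrand is the complex conjugate of its value at \<open>t\<close>, so its real part is even.
\<close>

lemma std_density_half_line:
  assumes "\<bar>\<beta>\<bar> \<le> 1" "\<theta> \<in> {0..1/20}"
  shows "std_density \<beta> x \<theta> =
    1 / pi * Re (CLINT t:{0<..}|lborel. exp (- \<i> * of_real t * of_real x) * half_cf \<beta> \<theta> t)"
proof -
  define f where "f t = exp (- \<i> * of_real t * of_real x) * stable_cf t (2 - \<theta>) \<beta>" for t :: real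
  define h where "h t = exp (- \<i> * of_real t * of_real x) * half_cf \<beta> \<theta> t" for t :: real
  have int_f: "integrable lborel f"
    unfolding f_def using assms by (rule integrable_fourier_stable_cf)
  have int_h: "set_integrable lborel {0<..} h"
    unfolding h_def using assms by (intro set_integrable_fourier integrable_half_cf)
  have "f (- t) = cnj (f t)" for t
    by (simp add: f_def stable_cf_uminus exp_cnj)
  then have even: "Re (f (- t)) = Re (f t)" for t
    by simp
  have eq: "Re (indicator {0<..} t *\<^sub>R h t) = indicator {0..} t *\<^sub>R Re (f t)" if "t \<notin> {0}" for t
    using that stable_cf_pos[of t \<theta> \<beta>] by (auto simp: indicator_def f_def h_def)
  have "has_bochner_integral lborel (\<lambda>t. indicator {0<..} t *\<^sub>R h t) (CLINT t:{0<..}|lborel. h t)"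
    using int_h unfolding set_integrable_def set_lebesgue_integral_def by (rule has_bochner_integral_integrable)
  then have "has_bochner_integral lborel (\<lambda>t. Re (indicator {0<..} t *\<^sub>R h t)) (Re (CLINT t:{0<..}|lborel. h t))"
    by (rule has_bochner_integral_Re)
  then have "has_bochner_integral lborel (\<lambda>t. indicator {0..} t *\<^sub>R Re (f t)) (Re (CLINT t:{0<..}|lborel. h t))"
    by (rule has_bochner_integral_discrete_difference[where X = "{0}", THEN iffD1, rotated 4])
      (use eq in \<open>auto\<close>)
  then have "has_bochner_integral lborel (\<lambda>t. Re (f t)) (2 *\<^sub>R Re (CLINT t:{0<..}|lborel. h t))"
    by (rule has_bochner_integral_even_function) (rule even)
  then have "(LINT t|lborel. Re (f t)) = 2 * Re (CLINT t:{0<..}|lborel. h t)"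
    by (simp add: has_bochner_integral_integral_eq)
  then have "Re (CLINT t|lborel. f t) = 2 * Re (CLINT t:{0<..}|lborel. h t)"
    using int_f by (simp add: integral_Re)
  then show ?thesis
    unfolding std_density_def stable_density_def Re_inversion_factor by (simp add: f_def h_def)
qed

text \<open>
  At \<open>0\<close> the characteristic function is 1 and its one-sided derivative is \<open>skew \<beta> \<theta>\<close>, which is
  imaginary. The boundary term \<open>skew \<beta> \<theta> + \<i> x\<close> therefore has no real part.
\<close>

lemma std_density_by_parts:
  assumes "\<bar>\<beta>\<bar> \<le> 1" "\<theta> \<in> {0..1/20}"
  shows "x\<^sup>2 * std_density \<beta> x \<theta> =
    - (1 / pi * Re (CLINT t:{0<..}|lborel. exp (- \<i> * of_real t * of_real x) * half_cf'' \<beta> \<theta> t))"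
proof -
  define I where "I = (CLINT t:{0<..}|lborel. exp (- \<i> * of_real t * of_real x) * half_cf \<beta> \<theta> t)"
  define J where "J = (CLINT t:{0<..}|lborel. exp (- \<i> * of_real t * of_real x) * half_cf'' \<beta> \<theta> t)"
  have powr_0: "((\<lambda>t. complex_of_real (t powr a)) \<longlongrightarrow> of_real 0) (at_right 0)" if "a > 0" for a
  proof -
    have "((\<lambda>t. t powr a) \<longlongrightarrow> 0 powr a) (at_right (0::real))"
      by (intro tendsto_powr' tendsto_ident_at tendsto_const) (use that in \<open>auto simp: eventually_at_filter\<close>)
    then show ?thesis
      by (intro tendsto_of_real) simp
  qed
  have "(half_exponent \<beta> \<theta> \<longlongrightarrow> skew \<beta> \<theta> * of_real 0 - (1 + skew \<beta> \<theta>) * of_real 0) (at_right 0)"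
    unfolding half_exponent_def
    by (intro tendsto_intros powr_0) (use assms in auto)
  then have "((\<lambda>t. exp (half_exponent \<beta> \<theta> t)) \<longlongrightarrow> exp 0) (at_right 0)"
    by (intro tendsto_exp) simp
  then have lim_0: "(half_cf \<beta> \<theta> \<longlongrightarrow> 1) (at_right 0)"
    by (simp add: half_cf_def[abs_def])
  have "(half_exponent' \<beta> \<theta> \<longlongrightarrow>
      skew \<beta> \<theta> - (1 + skew \<beta> \<theta>) * of_real (2 - \<theta>) * of_real 0) (at_right 0)"
    unfolding half_exponent'_def
    by (intro tendsto_intros powr_0) (use assms in auto)
  from tendsto_mult[OF this lim_0] have lim_0': "(half_cf' \<beta> \<theta> \<longlongrightarrow> skew \<beta> \<theta>) (at_right 0)"
    by (simp add: half_cf'_def[abs_def])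
  have lim_infty: "(half_cf \<beta> \<theta> \<longlongrightarrow> 0) at_top"
  proof (rule Lim_null_comparison[OF _ dominator_tendsto_0])
    show "\<forall>\<^sub>F t in at_top. norm (half_cf \<beta> \<theta> t) \<le> dominator t"
      using eventually_gt_at_top[of 0]
      by eventually_elim
        (use theta_lip_cf_dominator[OF assms(1)] assms(2) in \<open>auto simp: theta_lip_def\<close>)
  qed
  have lim_infty': "(half_cf' \<beta> \<theta> \<longlongrightarrow> 0) at_top"
  proof (rule Lim_null_comparison[OF _ dominator_tendsto_0])
    show "\<forall>\<^sub>F t in at_top. norm (half_cf' \<beta> \<theta> t) \<le> dominator t"
      using eventually_gt_at_top[of 0]
      by eventually_elim (rule norm_half_cf'_le[OF assms(1) _ assms(2)])
  qed
  have cont: "isCont (half_cf'' \<beta> \<theta>) t" if "t > 0" for t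
  proof -
    have p: "isCont (\<lambda>t. complex_of_real (t powr a)) t" for a
      using DERIV_isCont[OF has_real_derivative_powr[OF that, of a]] by (rule isCont_of_real)
    show ?thesis
      unfolding half_cf''_def half_exponent'_def half_exponent''_def half_cf_def half_exponent_def
      by (rule p continuous_intros)+
  qed
  have "of_real (x\<^sup>2) * I = - (skew \<beta> \<theta> + \<i> * of_real x * 1) - J"
    unfolding I_def J_def
    by (intro fourier_half_line_by_parts[OF half_cf_has_vector_derivative half_cf'_has_vector_derivative cont]
        integrable_half_cf integrable_half_cf'' lim_0 lim_0' lim_infty lim_infty' assms)
  then have "Re (of_real (x\<^sup>2) * I) = Re (- (skew \<beta> \<theta> + \<i> * of_real x * 1) - J)"
    by (rule arg_cong)
  then have "x\<^sup>2 * Re I = - Re J"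
    by (simp add: skew_def)
  then show ?thesis
    unfolding std_density_half_line[OF assms] I_def[symmetric] J_def[symmetric]
    by (simp add: field_simps)
qed

lemma norm_fourier_diff_le:
  fixes h0 h1 :: "real \<Rightarrow> complex"
  assumes "set_integrable lborel {0<..} h0" "set_integrable lborel {0<..} h1"
    and le: "\<And>t. t > 0 \<Longrightarrow> norm (h1 t - h0 t) \<le> dominator t * \<theta>"
  shows "\<bar>Re (CLINT t:{0<..}|lborel. exp (- \<i> * of_real t * of_real x) * h1 t) -
      Re (CLINT t:{0<..}|lborel. exp (- \<i> * of_real t * of_real x) * h0 t)\<bar> \<le>
    (LINT t:{0<..}|lborel. dominator t) * \<theta>" (is "\<bar>Re ?I1 - Re ?I0\<bar> \<le> _")
proof -
  let ?e = "\<lambda>t. exp (- \<i> * complex_of_real t * of_real x)"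
  have int: "set_integrable lborel {0<..} (\<lambda>t. ?e t * h1 t)" "set_integrable lborel {0<..} (\<lambda>t. ?e t * h0 t)"
    by (intro set_integrable_fourier assms)+
  have "\<bar>Re ?I1 - Re ?I0\<bar> \<le> norm (?I1 - ?I0)"
    using abs_Re_le_cmod[of "?I1 - ?I0"] by simp
  also have "?I1 - ?I0 = (CLINT t:{0<..}|lborel. ?e t * h1 t - ?e t * h0 t)"
    using int by (simp add: set_integral_diff)
  also have "norm \<dots> \<le> (LINT t:{0<..}|lborel. dominator t * \<theta>)"
    unfolding set_lebesgue_integral_def
  proof (rule Bochner_Integration.integral_norm_bound_integral)
    show "integrable lborel (\<lambda>t. indicator {0<..} t *\<^sub>R (?e t * h1 t - ?e t * h0 t))"
      using set_integral_diff(1)[OF int] by (simp add: set_integrable_def)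
    show "integrable lborel (\<lambda>t. indicator {0<..} t *\<^sub>R (dominator t * \<theta>))"
      using set_integrable_mult_left[OF dominator_integrable, of \<theta>] by (simp add: set_integrable_def)
    show "norm (indicator {0<..} t *\<^sub>R (?e t * h1 t - ?e t * h0 t)) \<le> indicator {0<..} t *\<^sub>R (dominator t * \<theta>)" for t
      using le[of t] by (auto simp: indicator_def norm_mult simp flip: right_diff_distrib)
  qed
  finally show ?thesis
    by simp
qed

text \<open>
  The inversion formula bounds the difference itself, and \<open>std_density_by_parts\<close> bounds \<open>x\<^sup>2\<close> times the
  difference; both times the integrand is at most \<open>\<theta>\<close> times the dominator. Together they give a
  bound that is integrable in \<open>x\<close>.
\<close>

lemma std_density_diff_le:
  assumes "\<bar>\<beta>\<bar> \<le> 1"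
  obtains C where "C > 0"
    "\<And>\<theta> x. \<theta> \<in> {0..1/20} \<Longrightarrow> \<bar>std_density \<beta> x \<theta> - std_density \<beta> x 0\<bar> \<le> \<theta> * (C / (1 + x\<^sup>2))"
proof
  define C where "C = (LINT t:{0<..}|lborel. dominator t)"
  have "C \<ge> 0"
    unfolding C_def set_lebesgue_integral_def by (intro Bochner_Integration.integral_nonneg) auto
  then show "2 * C + 1 > 0"
    by simp
  fix \<theta> x :: real assume \<theta>: "\<theta> \<in> {0..1/20}"
  define d where "d = std_density \<beta> x \<theta> - std_density \<beta> x 0"
  have 0: "0 \<in> {0..1/20::real}"
    by simp
  have "\<bar>d\<bar> \<le> 1 / pi * (C * \<theta>)"
  proof -
    have "d = 1 / pi * (Re (CLINT t:{0<..}|lborel. exp (- \<i> * of_real t * of_real x) * half_cf \<beta> \<theta> t) -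
        Re (CLINT t:{0<..}|lborel. exp (- \<i> * of_real t * of_real x) * half_cf \<beta> 0 t))"
      unfolding d_def std_density_half_line[OF assms \<theta>] std_density_half_line[OF assms 0]
      by (simp add: right_diff_distrib)
    moreover have "\<bar>Re (CLINT t:{0<..}|lborel. exp (- \<i> * of_real t * of_real x) * half_cf \<beta> \<theta> t) -
        Re (CLINT t:{0<..}|lborel. exp (- \<i> * of_real t * of_real x) * half_cf \<beta> 0 t)\<bar> \<le> C * \<theta>"
      unfolding C_def using theta_lip_cf_dominator[OF assms] \<theta>
      by (intro norm_fourier_diff_le integrable_half_cf assms) (auto simp: theta_lip_def)
    ultimately show ?thesis
      by (simp add: abs_mult divide_right_mono)
  qed
  moreover have "x\<^sup>2 * \<bar>d\<bar> \<le> 1 / pi * (C * \<theta>)"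
  proof -
    have "x\<^sup>2 * d = - (1 / pi * (Re (CLINT t:{0<..}|lborel. exp (- \<i> * of_real t * of_real x) * half_cf'' \<beta> \<theta> t) -
        Re (CLINT t:{0<..}|lborel. exp (- \<i> * of_real t * of_real x) * half_cf'' \<beta> 0 t)))"
      unfolding d_def right_diff_distrib std_density_by_parts[OF assms \<theta>] std_density_by_parts[OF assms 0]
      by simp
    moreover have "\<bar>Re (CLINT t:{0<..}|lborel. exp (- \<i> * of_real t * of_real x) * half_cf'' \<beta> \<theta> t) -
        Re (CLINT t:{0<..}|lborel. exp (- \<i> * of_real t * of_real x) * half_cf'' \<beta> 0 t)\<bar> \<le> C * \<theta>"
      unfolding C_def using theta_lip_half_cf''[OF assms] \<theta>
      by (intro norm_fourier_diff_le integrable_half_cf'' assms) (auto simp: theta_lip_def)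
    ultimately have "\<bar>x\<^sup>2 * d\<bar> \<le> 1 / pi * (C * \<theta>)"
      by (simp add: abs_mult divide_right_mono)
    then show ?thesis
      by (simp add: abs_mult)
  qed
  moreover have "1 / pi * (C * \<theta>) \<le> C * \<theta>"
    using \<open>C \<ge> 0\<close> \<theta> pi_ge_two mult_right_mono[of "1 / pi" 1 "C * \<theta>"] by simp
  ultimately have "(1 + x\<^sup>2) * \<bar>d\<bar> \<le> 2 * C * \<theta>"
    by (simp add: algebra_simps)
  also have "\<dots> \<le> \<theta> * (2 * C + 1)"
    using \<theta> by (simp add: algebra_simps)
  finally show "\<bar>std_density \<beta> x \<theta> - std_density \<beta> x 0\<bar> \<le> \<theta> * ((2 * C + 1) / (1 + x\<^sup>2))"
    unfolding d_def[symmetric] by (simp add: field_simps add_pos_nonneg)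
qed

text \<open>
  The inversion integral is the characteristic function of the standard normal law, evaluated at
  \<open>- x / sqrt 2\<close> after the substitution \<open>u = sqrt 2 * t\<close>.
\<close>

lemma std_density_0: "std_density \<beta> x 0 = exp (- (x\<^sup>2 / 4)) / (2 * sqrt pi)"
proof -
  have "exp (- (x\<^sup>2 / 4)) = Re (char std_normal_distribution (- x / sqrt 2))"
    unfolding Characteristic_Functions.char_std_normal_distribution by (simp add: power_divide)
  also have "char std_normal_distribution (- x / sqrt 2) =
      (CLINT u|lborel. std_normal_density u *\<^sub>R iexp (- x / sqrt 2 * u))"
    unfolding char_def by (subst integral_density) auto
  also have "\<dots> = sqrt 2 *\<^sub>R (CLINT t|lborel. std_normal_density (0 + sqrt 2 * t) *\<^sub>R iexp (- x / sqrt 2 * (0 + sqrt 2 * t)))"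
    by (subst lborel_integral_real_affine[where c = "sqrt 2" and t = 0]) auto
  also have "(\<lambda>t. std_normal_density (0 + sqrt 2 * t) *\<^sub>R iexp (- x / sqrt 2 * (0 + sqrt 2 * t))) =
      (\<lambda>t. (1 / sqrt (2 * pi)) *\<^sub>R (exp (- \<i> * of_real t * of_real x) * stable_cf t 2 \<beta>))"
  proof
    fix t :: real
    have "std_normal_density (0 + sqrt 2 * t) = 1 / sqrt (2 * pi) * exp (- t\<^sup>2)"
      by (simp add: std_normal_density_def power_mult_distrib)
    moreover have "- x / sqrt 2 * (0 + sqrt 2 * t) = - (x * t)"
      by simp
    ultimately show "std_normal_density (0 + sqrt 2 * t) *\<^sub>R iexp (- x / sqrt 2 * (0 + sqrt 2 * t)) =
        (1 / sqrt (2 * pi)) *\<^sub>R (exp (- \<i> * of_real t * of_real x) * stable_cf t 2 \<beta>)"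
      by (simp only: stable_cf_2) (simp add: scaleR_conv_of_real mult_ac flip: exp_of_real)
  qed
  also have "Re (sqrt 2 *\<^sub>R (CLINT t|lborel. (1 / sqrt (2 * pi)) *\<^sub>R (exp (- \<i> * of_real t * of_real x) * stable_cf t 2 \<beta>))) =
      1 / sqrt pi * Re (CLINT t|lborel. exp (- \<i> * of_real t * of_real x) * stable_cf t 2 \<beta>)"
    by (simp add: real_sqrt_mult)
  finally have *: "exp (- (x\<^sup>2 / 4)) =
      1 / sqrt pi * Re (CLINT t|lborel. exp (- \<i> * of_real t * of_real x) * stable_cf t 2 \<beta>)" .
  have "std_density \<beta> x 0 =
      1 / (2 * pi) * Re (CLINT t|lborel. exp (- \<i> * of_real t * of_real x) * stable_cf t 2 \<beta>)"
    unfolding std_density_def stable_density_def Re_inversion_factor by simp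
  also have "\<dots> = 1 / (2 * pi) * (sqrt pi * exp (- (x\<^sup>2 / 4)))"
    unfolding * by simp
  also have "\<dots> = exp (- (x\<^sup>2 / 4)) / (2 * sqrt pi)"
    using real_sqrt_mult_self[of pi] by (simp add: field_simps)
  finally show ?thesis .
qed

lemma std_density_0_pos: "std_density \<beta> x 0 > 0"
  unfolding std_density_0 by simp

section \<open>The score as a right derivative of the density\<close>

text \<open>
  Only the existence of the derivative matters: its value enters the score through
  \<open>vector_derivative\<close>. The tangent is differentiable at \<open>\<alpha> = 2\<close> because \<open>cos pi \<noteq> 0\<close>.
\<close>

lemma stable_cf_differentiable_alpha:
  "\<exists>D. ((\<lambda>\<alpha>. stable_cf t \<alpha> \<beta>) has_vector_derivative D) (at 2)"
proof (cases "t = 0")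
  case True
  then show ?thesis
    by (auto intro: exI[of _ 0])
next
  case False
  define m where "m \<alpha> = \<bar>t\<bar> powr \<alpha>" for \<alpha>
  define s where "s \<alpha> = \<beta> * sgn t * tan (pi * \<alpha> / 2) * (\<bar>t\<bar> powr (1 - \<alpha>) - 1)" for \<alpha>
  have powr: "\<bar>t\<bar> powr \<alpha> = exp (\<alpha> * ln \<bar>t\<bar>)" for \<alpha>
    using False by (simp add: powr_def)
  have "(m has_real_derivative ln \<bar>t\<bar> * exp (2 * ln \<bar>t\<bar>)) (at 2)"
    unfolding m_def powr by (auto intro!: derivative_eq_intros)
  then have m: "((\<lambda>\<alpha>. complex_of_real (m \<alpha>)) has_vector_derivative of_real (ln \<bar>t\<bar> * exp (2 * ln \<bar>t\<bar>))) (at 2)"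
    by (rule has_vector_derivative_of_real)
  have "\<exists>d. (s has_real_derivative d) (at 2)"
    unfolding s_def powr
    by (rule exI) (rule derivative_eq_intros refl | simp)+
  then obtain d where "(s has_real_derivative d) (at 2)" ..
  then have s: "((\<lambda>\<alpha>. complex_of_real (s \<alpha>)) has_vector_derivative of_real d) (at 2)"
    by (rule has_vector_derivative_of_real)
  have "\<exists>D. ((\<lambda>\<alpha>. - complex_of_real (m \<alpha>) * (1 + \<i> * complex_of_real (s \<alpha>))) has_vector_derivative D) (at 2)"
    by (rule exI) (rule derivative_eq_intros m s refl)+
  then obtain D where "((\<lambda>\<alpha>. - complex_of_real (m \<alpha>) * (1 + \<i> * complex_of_real (s \<alpha>))) has_vector_derivative D) (at 2)" ..
  from field_vector_diff_chain_at[OF this DERIV_exp] show ?thesis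
    unfolding o_def m_def s_def stable_cf_def by blast
qed

lemma has_vector_derivative_imp_right_quotient:
  assumes "(f has_vector_derivative D) (at (a::real))"
  shows "((\<lambda>h. (1 / h) *\<^sub>R (f (a + h) - f a)) \<longlongrightarrow> D) (at_right 0)"
proof -
  have "((f \<circ> (\<lambda>h. a + h)) has_vector_derivative 1 *\<^sub>R D) (at 0)"
    by (rule vector_diff_chain_at) (use assms in \<open>auto intro!: derivative_eq_intros\<close>)
  then have "((\<lambda>h. (1 / norm h) *\<^sub>R (f (a + h) - (f a + h *\<^sub>R D))) \<longlongrightarrow> 0) (at 0)"
    by (simp add: has_vector_derivative_def has_derivative_within o_def)
  then have "((\<lambda>h. (1 / norm h) *\<^sub>R (f (a + h) - (f a + h *\<^sub>R D))) \<longlongrightarrow> 0) (at_right 0)"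
    by (rule tendsto_within_subset) simp
  then have "((\<lambda>h. (1 / h) *\<^sub>R (f (a + h) - f a) - D) \<longlongrightarrow> 0) (at_right 0)"
  proof (rule Lim_transform_eventually)
    show "\<forall>\<^sub>F h in at_right 0. (1 / norm h) *\<^sub>R (f (a + h) - (f a + h *\<^sub>R D)) =
        (1 / h) *\<^sub>R (f (a + h) - f a) - D"
      using eventually_at_right_less[of 0]
      by eventually_elim (simp add: scaleR_right_diff_distrib scaleR_right_distrib)
  qed
  then show ?thesis
    by (rule LIM_zero_cancel)
qed

text \<open>
  The sign changes because \<open>\<theta> = 2 - \<alpha>\<close>, and it cancels the minus sign in the definition of the score.
\<close>

lemma stable_cf_right_quotient:
  "((\<lambda>\<theta>. (1 / \<theta>) *\<^sub>R (stable_cf t (2 - \<theta>) \<beta> - stable_cf t 2 \<beta>)) \<longlongrightarrow>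
     - vector_derivative (\<lambda>\<alpha>. stable_cf t \<alpha> \<beta>) (at 2 within {0<..2})) (at_right 0)"
proof -
  obtain D where D: "((\<lambda>\<alpha>. stable_cf t \<alpha> \<beta>) has_vector_derivative D) (at 2)"
    using stable_cf_differentiable_alpha by blast
  have "at 2 within {0<..2} = at_left (2::real)"
    by (rule at_within_nhd[where S = "{0<..}"]) auto
  then have "at 2 within {0<..2} \<noteq> (bot :: real filter)"
    by simp
  then have "vector_derivative (\<lambda>\<alpha>. stable_cf t \<alpha> \<beta>) (at 2 within {0<..2}) = D"
    by (rule vector_derivative_within) (rule has_vector_derivative_at_within[OF D])
  moreover have "(((\<lambda>\<alpha>. stable_cf t \<alpha> \<beta>) \<circ> (\<lambda>\<theta>. 2 - \<theta>)) has_vector_derivative (- 1) *\<^sub>R D) (at 0)"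
    by (rule vector_diff_chain_at) (use D in \<open>auto intro!: derivative_eq_intros\<close>)
  from has_vector_derivative_imp_right_quotient[OF this]
  have "((\<lambda>\<theta>. (1 / \<theta>) *\<^sub>R (stable_cf t (2 - \<theta>) \<beta> - stable_cf t 2 \<beta>)) \<longlongrightarrow> - D) (at_right 0)"
    by simp
  ultimately show ?thesis
    by simp
qed

text \<open>
  The difference quotients in the inversion integral are bounded by the dominator, so the limit may
  be taken under the integral sign.
\<close>

lemma std_density_right_derivative:
  assumes "\<bar>\<beta>\<bar> \<le> 1"
  shows "((\<lambda>\<theta>. (std_density \<beta> x \<theta> - std_density \<beta> x 0) / \<theta>) \<longlongrightarrow> score0 \<beta> x * std_density \<beta> x 0) (at_right 0)"
proof (rule tendsto_at_right_sequentially[of _ "1 / 20"])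
  fix S :: "nat \<Rightarrow> real"
  assume S: "\<And>n. 0 < S n" "\<And>n. S n < 1 / 20" "S \<longlonglongrightarrow> 0"
  define V where "V t = vector_derivative (\<lambda>\<alpha>. stable_cf t \<alpha> \<beta>) (at 2 within {0<..2})" for t
  define e where "e t = exp (- \<i> * of_real t * of_real x)" for t :: real
  define q where "q n t = e t * ((1 / S n) *\<^sub>R (stable_cf t (2 - S n) \<beta> - stable_cf t 2 \<beta>))" for n t
  have e [measurable]: "e \<in> borel_measurable borel"
    unfolding e_def by measurable
  have S0: "filterlim S (at_right 0) sequentially"
    unfolding filterlim_at using S(3) by (auto intro!: always_eventually simp: S(1) less_imp_neq[OF S(1), symmetric])
  have lim: "(\<lambda>n. q n t) \<longlonglongrightarrow> - (e t * V t)" for t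
  proof -
    have "(\<lambda>n. q n t) \<longlonglongrightarrow> e t * - V t"
      unfolding q_def V_def
      by (intro tendsto_intros filterlim_compose[OF stable_cf_right_quotient S0])
    then show ?thesis
      by simp
  qed
  have q [measurable]: "q n \<in> borel_measurable borel" for n
    unfolding q_def by measurable
  have "(\<lambda>n. CLINT t|lborel. q n t) \<longlonglongrightarrow> (CLINT t|lborel. - (e t * V t))"
  proof (rule integral_dominated_convergence)
    show "(\<lambda>t. - (e t * V t)) \<in> borel_measurable lborel"
      by (rule borel_measurable_LIMSEQ_metric[where f = q]) (use lim in auto)
    show "integrable lborel (\<lambda>t. dominator \<bar>t\<bar>)"
      by (rule integrable_dominator_abs)
    fix n
    have Sn: "S n \<in> {0..1/20}"
      using S(1)[of n] S(2)[of n] by auto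
    show "AE t in lborel. norm (q n t) \<le> dominator \<bar>t\<bar>"
    proof (rule AE_I2)
      fix t
      have "norm (q n t) = norm (stable_cf t (2 - S n) \<beta> - stable_cf t 2 \<beta>) / S n"
        using S(1)[of n] by (simp add: q_def e_def norm_mult)
      also have "\<dots> \<le> (dominator \<bar>t\<bar> * S n) / S n"
        using S(1)[of n] by (intro divide_right_mono norm_stable_cf_diff_le assms Sn) auto
      also have "\<dots> = dominator \<bar>t\<bar>"
        using S(1)[of n] by simp
      finally show "norm (q n t) \<le> dominator \<bar>t\<bar>" .
    qed
  qed (use lim in auto)
  then have "(\<lambda>n. 1 / (2 * pi) * Re (CLINT t|lborel. q n t)) \<longlonglongrightarrow>
      1 / (2 * pi) * Re (CLINT t|lborel. - (e t * V t))"
    by (intro tendsto_intros)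
  moreover have "1 / (2 * pi) * Re (CLINT t|lborel. q n t) = (std_density \<beta> x (S n) - std_density \<beta> x 0) / S n" for n
  proof -
    have int: "integrable lborel (\<lambda>t. e t * stable_cf t (2 - \<theta>) \<beta>)" if "\<theta> \<in> {0..1/20}" for \<theta>
      unfolding e_def by (rule integrable_fourier_stable_cf[OF assms that])
    have Sn: "S n \<in> {0..1/20}"
      using S(1)[of n] S(2)[of n] by auto
    have "q n = (\<lambda>t. (1 / S n) *\<^sub>R (e t * stable_cf t (2 - S n) \<beta> - e t * stable_cf t (2 - 0) \<beta>))"
      by (simp add: q_def fun_eq_iff algebra_simps)
    then have "(CLINT t|lborel. q n t) = (1 / S n) *\<^sub>R
        ((CLINT t|lborel. e t * stable_cf t (2 - S n) \<beta>) - (CLINT t|lborel. e t * stable_cf t (2 - 0) \<beta>))"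
      using int[OF Sn] int[of 0] by simp
    then show ?thesis
      unfolding std_density_def stable_density_def Re_inversion_factor
      by (simp add: e_def divide_simps right_diff_distrib)
  qed
  moreover have "1 / (2 * pi) * Re (CLINT t|lborel. - (e t * V t)) = score0 \<beta> x * std_density \<beta> x 0"
  proof -
    have "Re (- (1 / (2 * complex_of_real pi)) * z) = - (1 / (2 * pi) * Re z)" for z
      unfolding Re_inversion_factor[symmetric] by simp
    then show ?thesis
      using std_density_0_pos[of \<beta> x] by (simp add: score0_def e_def V_def)
  qed
  ultimately show "(\<lambda>n. (std_density \<beta> x (S n) - std_density \<beta> x 0) / S n) \<longlonglongrightarrow> score0 \<beta> x * std_density \<beta> x 0"
    by simp
qed simp

lemma std_density_measurable [measurable]: "(\<lambda>x. std_density \<beta> x \<theta>) \<in> borel_measurable borel"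
  unfolding std_density_def by measurable

section \<open>The density of the sample and the derivative of the power\<close>

text \<open>
  The score times the normal density is a pointwise limit of difference quotients of measurable
  functions.
\<close>

lemma score0_measurable:
  assumes "\<bar>\<beta>\<bar> \<le> 1"
  shows "score0 \<beta> \<in> borel_measurable borel"
proof -
  have lim: "filterlim (\<lambda>n. 1 / real (Suc n)) (at_right 0) sequentially"
    unfolding filterlim_at using LIMSEQ_Suc[OF lim_1_over_n] by (auto intro: always_eventually)
  have "(\<lambda>x. score0 \<beta> x * std_density \<beta> x 0) \<in> borel_measurable borel"
  proof (rule borel_measurable_LIMSEQ_metric)
    show "(\<lambda>x. (std_density \<beta> x (1 / real (Suc n)) - std_density \<beta> x 0) / (1 / real (Suc n)))
        \<in> borel_measurable borel" for n
      by measurable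
    show "(\<lambda>n. (std_density \<beta> x (1 / real (Suc n)) - std_density \<beta> x 0) / (1 / real (Suc n)))
        \<longlonglongrightarrow> score0 \<beta> x * std_density \<beta> x 0" for x
      by (rule filterlim_compose[OF std_density_right_derivative[OF assms] lim])
  qed
  then have "(\<lambda>x. score0 \<beta> x * std_density \<beta> x 0 / std_density \<beta> x 0) \<in> borel_measurable borel"
    by measurable
  also have "(\<lambda>x. score0 \<beta> x * std_density \<beta> x 0 / std_density \<beta> x 0) = score0 \<beta>"
    using std_density_0_pos[of \<beta>] by (auto simp: fun_eq_iff less_imp_neq[symmetric])
  finally show ?thesis .
qed

abbreviation lebesgue_n :: "nat \<Rightarrow> (nat \<Rightarrow> real) measure" where
  "lebesgue_n n \<equiv> PiM {..<n} (\<lambda>_. lborel)"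

interpretation lborel_product: product_sigma_finite "\<lambda>_::nat. lborel :: real measure"
  by standard

lemma sets_lebesgue_n: "sets (lebesgue_n n) = sets (sample_space n)"
  by (intro sets_PiM_cong) auto

lemma space_lebesgue_n: "space (lebesgue_n n) = space (sample_space n)"
  by (rule sets_eq_imp_space_eq[OF sets_lebesgue_n])

text \<open>
  The law of an observation is defined through \<open>ennreal\<close>, which sends negative reals to 0; its density
  is therefore the positive part of the inversion integral. Because the normal density is positive,
  taking positive parts changes neither the bounds nor the right derivative at \<open>\<theta> = 0\<close>.
\<close>

definition joint :: "nat \<Rightarrow> real \<Rightarrow> real \<Rightarrow> (nat \<Rightarrow> real) \<Rightarrow> real" where
  "joint n \<beta> \<theta> x = (\<Prod>i<n. max 0 (std_density \<beta> (x i) \<theta>))"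

lemma joint_nonneg [simp]: "joint n \<beta> \<theta> x \<ge> 0"
  unfolding joint_def by (intro prod_nonneg) auto

lemma joint_measurable [measurable]: "joint n \<beta> \<theta> \<in> borel_measurable (lebesgue_n n)"
  unfolding joint_def by measurable

lemma stable_sample_eq_density:
  "stable_sample n \<beta> 0 1 \<theta> = density (lebesgue_n n) (\<lambda>x. ennreal (joint n \<beta> \<theta> x))"
proof -
  define f where "f x = ennreal (ls_density \<beta> 0 1 x \<theta>)" for x
  have f_eq: "f x = ennreal (max 0 (std_density \<beta> x \<theta>))" for x
    by (cases "std_density \<beta> x \<theta> \<ge> 0") (auto simp: f_def ls_density_def ennreal_neg)
  have f [measurable]: "f \<in> borel_measurable borel"
    unfolding f_def by measurable
  have sf: "product_sigma_finite (\<lambda>_::nat. density lborel f)"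
    unfolding product_sigma_finite_def f_def
    by (subst sigma_finite_measure.sigma_finite_iff_density_finite[OF lborel.sigma_finite_measure_axioms]) auto
  have "density (lebesgue_n n) (\<lambda>x. ennreal (joint n \<beta> \<theta> x)) = PiM {..<n} (\<lambda>_. density lborel f)"
  proof (rule product_sigma_finite.PiM_eqI[OF sf])
    show "sets (density (lebesgue_n n) (\<lambda>x. ennreal (joint n \<beta> \<theta> x))) = sets (PiM {..<n} (\<lambda>_. density lborel f))"
      by (simp cong: sets_PiM_cong)
    fix A :: "nat \<Rightarrow> real set"
    assume A: "\<And>i. i \<in> {..<n} \<Longrightarrow> A i \<in> sets (density lborel f)"
    then have A' [measurable]: "\<And>i. i \<in> {..<n} \<Longrightarrow> A i \<in> sets borel"
      by simp
    have box: "Pi\<^sub>E {..<n} A \<in> sets (lebesgue_n n)"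
      using A' by (intro sets_PiM_I_finite) auto
    have "emeasure (density (lebesgue_n n) (\<lambda>x. ennreal (joint n \<beta> \<theta> x))) (Pi\<^sub>E {..<n} A) =
        (\<integral>\<^sup>+x. ennreal (joint n \<beta> \<theta> x) * indicator (Pi\<^sub>E {..<n} A) x \<partial>lebesgue_n n)"
      using box by (intro emeasure_density) measurable
    also have "\<dots> = (\<integral>\<^sup>+x. (\<Prod>i<n. f (x i) * indicator (A i) (x i)) \<partial>lebesgue_n n)"
    proof (rule nn_integral_cong)
      fix x assume "x \<in> space (lebesgue_n n)"
      then have "indicator (Pi\<^sub>E {..<n} A) x = (\<Prod>i<n. indicator (A i) (x i) :: ennreal)"
        by (auto simp: indicator_def PiE_iff space_PiM intro!: prod.neutral[symmetric] prod_zero[symmetric])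
      then show "ennreal (joint n \<beta> \<theta> x) * indicator (Pi\<^sub>E {..<n} A) x =
          (\<Prod>i<n. f (x i) * indicator (A i) (x i))"
        by (simp add: prod.distrib joint_def f_eq prod_ennreal)
    qed
    also have "\<dots> = (\<Prod>i<n. \<integral>\<^sup>+x. f x * indicator (A i) x \<partial>lborel)"
      by (rule lborel_product.product_nn_integral_prod) auto
    also have "\<dots> = (\<Prod>i<n. emeasure (density lborel f) (A i))"
      by (intro prod.cong refl emeasure_density[symmetric]) auto
    finally show "emeasure (density (lebesgue_n n) (\<lambda>x. ennreal (joint n \<beta> \<theta> x))) (Pi\<^sub>E {..<n} A) =
        (\<Prod>i<n. emeasure (density lborel f) (A i))" .
  qed simp
  then show ?thesis
    by (simp add: stable_sample_def f_def[abs_def])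
qed

lemma integrable_1_div_1_plus_square: "integrable lborel (\<lambda>x::real. 1 / (1 + x\<^sup>2))"
  using integrable_inverse_1_plus_square by (simp add: set_integrable_def inverse_eq_divide)

text \<open>
  One constant serves both for the positive parts of the densities and for their increments, so that \<open>abs_prod_diff_le\<close>
  applies. The normal density itself is of order \<open>1 / (1 + x\<^sup>2)\<close> since \<open>exp (x\<^sup>2 / 4) \<ge> 1 + x\<^sup>2 / 4\<close>.
\<close>

lemma density_dominated:
  assumes "\<bar>\<beta>\<bar> \<le> 1"
  obtains K where "K > 0"
    "\<And>\<theta> x. \<theta> \<in> {0..1/20} \<Longrightarrow> max 0 (std_density \<beta> x \<theta>) \<le> K / (1 + x\<^sup>2)"
    "\<And>\<theta> x. \<theta> \<in> {0..1/20} \<Longrightarrow>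
      \<bar>max 0 (std_density \<beta> x \<theta>) - max 0 (std_density \<beta> x 0)\<bar> \<le> \<theta> * (K / (1 + x\<^sup>2))"
proof -
  obtain C where C: "C > 0"
    "\<And>\<theta> x. \<theta> \<in> {0..1/20} \<Longrightarrow> \<bar>std_density \<beta> x \<theta> - std_density \<beta> x 0\<bar> \<le> \<theta> * (C / (1 + x\<^sup>2))"
    using std_density_diff_le[OF assms] by blast
  have f0: "std_density \<beta> x 0 \<le> 4 / (1 + x\<^sup>2)" for x
  proof -
    have "1 + x\<^sup>2 / 4 \<le> exp (x\<^sup>2 / 4)"
      by (rule exp_ge_add_one_self)
    then have "1 / exp (x\<^sup>2 / 4) \<le> 1 / (1 + x\<^sup>2 / 4)"
      by (intro divide_left_mono) (auto simp: add_pos_nonneg)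
    also have "\<dots> \<le> 4 / (1 + x\<^sup>2)"
      by (simp add: divide_simps add_pos_nonneg)
    finally have "exp (- (x\<^sup>2 / 4)) \<le> 4 / (1 + x\<^sup>2)"
      by (simp add: exp_minus inverse_eq_divide)
    moreover have "1 \<le> sqrt pi"
      using pi_ge_two by (intro real_sqrt_ge_one) simp
    then have "1 \<le> 2 * sqrt pi"
      by linarith
    then have "exp (- (x\<^sup>2 / 4)) / (2 * sqrt pi) \<le> exp (- (x\<^sup>2 / 4)) / 1"
      by (rule divide_left_mono) auto
    ultimately show ?thesis
      unfolding std_density_0 by simp
  qed
  show thesis
  proof
    show "4 + C > 0"
      using C(1) by simp
    fix \<theta> x :: real assume \<theta>: "\<theta> \<in> {0..1/20}"
    have diff: "\<bar>std_density \<beta> x \<theta> - std_density \<beta> x 0\<bar> \<le> \<theta> * (C / (1 + x\<^sup>2))"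
      by (rule C(2)[OF \<theta>])
    have pos: "0 \<le> C / (1 + x\<^sup>2)"
      using C(1) by (simp add: add_nonneg_nonneg)
    have "\<theta> * (C / (1 + x\<^sup>2)) \<le> 1 * (C / (1 + x\<^sup>2))"
      using \<theta> pos by (intro mult_right_mono) auto
    moreover have "(4 + C) / (1 + x\<^sup>2) = 4 / (1 + x\<^sup>2) + C / (1 + x\<^sup>2)"
      by (rule add_divide_distrib)
    moreover have "0 \<le> 4 / (1 + x\<^sup>2)"
      by (simp add: add_nonneg_nonneg)
    ultimately show "max 0 (std_density \<beta> x \<theta>) \<le> (4 + C) / (1 + x\<^sup>2)"
      using diff f0[of x] pos by linarith
    have "\<theta> * (C / (1 + x\<^sup>2)) \<le> \<theta> * ((4 + C) / (1 + x\<^sup>2))"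
      using \<theta> by (intro mult_left_mono divide_right_mono) (auto simp: add_nonneg_nonneg)
    then show "\<bar>max 0 (std_density \<beta> x \<theta>) - max 0 (std_density \<beta> x 0)\<bar> \<le> \<theta> * ((4 + C) / (1 + x\<^sup>2))"
      using diff by linarith
  qed
qed

text \<open>
  After division by \<open>w i\<close> all factors lie in the unit ball, where the product is 1-Lipschitz in each
  factor.
\<close>

lemma abs_prod_diff_le:
  fixes a b w :: "'i \<Rightarrow> real"
  assumes "finite I" "\<And>i. i \<in> I \<Longrightarrow> w i > 0" "\<And>i. i \<in> I \<Longrightarrow> \<bar>a i\<bar> \<le> w i" "\<And>i. i \<in> I \<Longrightarrow> \<bar>b i\<bar> \<le> w i"
    "\<And>i. i \<in> I \<Longrightarrow> \<bar>a i - b i\<bar> \<le> c * w i"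
  shows "\<bar>(\<Prod>i\<in>I. a i) - (\<Prod>i\<in>I. b i)\<bar> \<le> real (card I) * c * (\<Prod>i\<in>I. w i)"
proof -
  have "norm ((\<Prod>i\<in>I. a i / w i) - (\<Prod>i\<in>I. b i / w i)) \<le> (\<Sum>i\<in>I. norm (a i / w i - b i / w i))"
    using assms by (intro norm_prod_diff) (auto simp: divide_simps abs_of_pos)
  also have "\<dots> \<le> (\<Sum>i\<in>I. c)"
  proof (rule sum_mono)
    fix i assume i: "i \<in> I"
    show "norm (a i / w i - b i / w i) \<le> c"
      using assms(2)[OF i] assms(5)[OF i]
      by (simp add: pos_divide_le_eq flip: diff_divide_distrib)
  qed
  finally have *: "\<bar>(\<Prod>i\<in>I. a i / w i) - (\<Prod>i\<in>I. b i / w i)\<bar> \<le> real (card I) * c"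
    by simp
  have w: "(\<Prod>i\<in>I. w i) > 0"
    using assms(2) by (intro prod_pos) auto
  show ?thesis
    using * w unfolding prod_dividef by (simp add: divide_le_eq flip: diff_divide_distrib)
qed

definition sample_score :: "nat \<Rightarrow> real \<Rightarrow> (nat \<Rightarrow> real) \<Rightarrow> real" where
  "sample_score n \<beta> x = (\<Sum>i<n. score0 \<beta> (x i))"

text \<open>
  The product rule. Each density is continuous from the right at \<open>\<theta> = 0\<close> with a positive limit, hence
  equals its positive part for small \<open>\<theta>\<close>.
\<close>

lemma joint_right_derivative:
  assumes "\<bar>\<beta>\<bar> \<le> 1"
  shows "((\<lambda>\<theta>. (joint n \<beta> \<theta> x - joint n \<beta> 0 x) / \<theta>) \<longlongrightarrow> sample_score n \<beta> x * joint n \<beta> 0 x) (at_right 0)"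
proof -
  define g where "g i = score0 \<beta> (x i) * std_density \<beta> (x i) 0" for i
  have pos: "max 0 (std_density \<beta> (x i) 0) = std_density \<beta> (x i) 0" for i
    using std_density_0_pos[of \<beta> "x i"] by simp
  have deriv: "((\<lambda>\<theta>. max 0 (std_density \<beta> (x i) \<theta>)) has_field_derivative g i) (at 0 within {0<..})" for i
  proof -
    have "((\<lambda>\<theta>. std_density \<beta> (x i) \<theta>) has_field_derivative g i) (at 0 within {0<..})"
      using std_density_right_derivative[OF assms, of "x i"]
      by (simp add: has_field_derivative_iff g_def)
    moreover from DERIV_continuous[OF this]
    have "((\<lambda>\<theta>. std_density \<beta> (x i) \<theta>) \<longlongrightarrow> std_density \<beta> (x i) 0) (at_right 0)"
      by (simp add: continuous_within)
    from order_tendstoD(1)[OF this std_density_0_pos]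
    have "\<forall>\<^sub>F \<theta> in at_right 0. (std_density \<beta> (x i) \<theta> - std_density \<beta> (x i) 0) / \<theta> =
        (max 0 (std_density \<beta> (x i) \<theta>) - max 0 (std_density \<beta> (x i) 0)) / \<theta>"
      by eventually_elim (simp add: pos)
    ultimately show ?thesis
      unfolding has_field_derivative_iff by (auto intro: Lim_transform_eventually)
  qed
  have "((\<lambda>\<theta>. \<Prod>i<n. max 0 (std_density \<beta> (x i) \<theta>)) has_derivative
      (\<lambda>y. \<Sum>i<n. (g i * y) * (\<Prod>j\<in>{..<n}-{i}. max 0 (std_density \<beta> (x j) 0)))) (at 0 within {0<..})"
    using deriv unfolding has_field_derivative_def by (rule has_derivative_prod)
  also have "(\<lambda>y. \<Sum>i<n. (g i * y) * (\<Prod>j\<in>{..<n}-{i}. max 0 (std_density \<beta> (x j) 0))) =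
      (*) (sample_score n \<beta> x * joint n \<beta> 0 x)"
  proof
    fix y
    have eq: "(g i * y) * (\<Prod>j\<in>{..<n}-{i}. max 0 (std_density \<beta> (x j) 0)) =
        score0 \<beta> (x i) * joint n \<beta> 0 x * y" if "i < n" for i
      using prod.remove[of "{..<n}" i "\<lambda>j. max 0 (std_density \<beta> (x j) 0)"] that pos[of i]
      by (simp add: joint_def g_def)
    show "(\<Sum>i<n. (g i * y) * (\<Prod>j\<in>{..<n}-{i}. max 0 (std_density \<beta> (x j) 0))) =
        sample_score n \<beta> x * joint n \<beta> 0 x * y"
      unfolding sample_score_def sum_distrib_right by (intro sum.cong refl eq) auto
  qed
  finally show ?thesis
    unfolding has_field_derivative_def[symmetric] has_field_derivative_iff by (simp add: joint_def)
qed


lemma sample_score_measurable: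
  assumes "\<bar>\<beta>\<bar> \<le> 1"
  shows "sample_score n \<beta> \<in> borel_measurable (lebesgue_n n)"
proof -
  note score0_measurable[OF assms, measurable]
  show ?thesis
    unfolding sample_score_def by measurable
qed

text \<open>
  Differentiation under the integral sign: the difference quotients of the joint density are
  bounded by \<open>n\<close> times the product of the functions \<open>K / (1 + x\<^sub>i\<^sup>2)\<close>.
\<close>

lemma
  assumes "\<bar>\<beta>\<bar> \<le> 1"
  shows integrable_joint: "\<And>\<theta>. \<theta> \<in> {0..1/20} \<Longrightarrow> integrable (lebesgue_n n) (joint n \<beta> \<theta>)"
    and integrable_score_joint: "integrable (lebesgue_n n) (\<lambda>x. sample_score n \<beta> x * joint n \<beta> 0 x)"
    and integral_joint_right_derivative:
      "\<And>S. S \<in> sets (lebesgue_n n) \<Longrightarrow>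
        ((\<lambda>\<theta>. ((LINT x|lebesgue_n n. indicator S x * joint n \<beta> \<theta> x) -
              (LINT x|lebesgue_n n. indicator S x * joint n \<beta> 0 x)) / \<theta>)
          \<longlongrightarrow> (LINT x|lebesgue_n n. indicator S x * (sample_score n \<beta> x * joint n \<beta> 0 x))) (at_right 0)"
proof -
  obtain K where K: "K > 0"
    "\<And>\<theta> x. \<theta> \<in> {0..1/20} \<Longrightarrow> max 0 (std_density \<beta> x \<theta>) \<le> K / (1 + x\<^sup>2)"
    "\<And>\<theta> x. \<theta> \<in> {0..1/20} \<Longrightarrow>
      \<bar>max 0 (std_density \<beta> x \<theta>) - max 0 (std_density \<beta> x 0)\<bar> \<le> \<theta> * (K / (1 + x\<^sup>2))"
    using density_dominated[OF assms] by blast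
  define w where "w x = (\<Prod>i<n. K / (1 + (x i)\<^sup>2))" for x :: "nat \<Rightarrow> real"
  note [measurable] = sample_score_measurable[OF assms]
  have pos: "K / (1 + (x i)\<^sup>2) > 0" for x :: "nat \<Rightarrow> real" and i
    using K(1) by (simp add: add_pos_nonneg)
  have "integrable lborel (\<lambda>x::real. K * (1 / (1 + x\<^sup>2)))"
    by (intro integrable_mult_right integrable_1_div_1_plus_square)
  then have w: "integrable (lebesgue_n n) w"
    unfolding w_def by (intro lborel_product.product_integrable_prod) auto
  show joint: "integrable (lebesgue_n n) (joint n \<beta> \<theta>)" if "\<theta> \<in> {0..1/20}" for \<theta>
  proof (rule Bochner_Integration.integrable_bound[OF w])
    show "AE x in lebesgue_n n. norm (joint n \<beta> \<theta> x) \<le> norm (w x)"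
    proof (rule AE_I2)
      fix x
      have "joint n \<beta> \<theta> x \<le> w x"
        unfolding joint_def w_def using K(2)[OF that] by (intro prod_mono) auto
      then show "norm (joint n \<beta> \<theta> x) \<le> norm (w x)"
        using joint_nonneg[of n \<beta> \<theta> x] by simp
    qed
  qed measurable
  have lip: "\<bar>joint n \<beta> \<theta> x - joint n \<beta> 0 x\<bar> \<le> real n * \<theta> * w x" if "\<theta> \<in> {0..1/20}" for \<theta> x
    using abs_prod_diff_le[of "{..<n}" "\<lambda>i. K / (1 + (x i)\<^sup>2)" "\<lambda>i. max 0 (std_density \<beta> (x i) \<theta>)"
        "\<lambda>i. max 0 (std_density \<beta> (x i) 0)" \<theta>] pos K(2)[OF that] K(2)[of 0] K(3)[OF that]
    by (simp add: joint_def w_def)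
  have main: "integrable (lebesgue_n n) (\<lambda>x. indicator R x * (sample_score n \<beta> x * joint n \<beta> 0 x)) \<and>
      (\<lambda>k. ((LINT x|lebesgue_n n. indicator R x * joint n \<beta> (S k) x) -
          (LINT x|lebesgue_n n. indicator R x * joint n \<beta> 0 x)) / S k)
        \<longlonglongrightarrow> (LINT x|lebesgue_n n. indicator R x * (sample_score n \<beta> x * joint n \<beta> 0 x))"
    if R [measurable]: "R \<in> sets (lebesgue_n n)"
      and S: "\<And>k. 0 < S k" "\<And>k. S k < 1 / 20" "S \<longlonglongrightarrow> 0" for R S
  proof -
    define q where "q k x = indicator R x * ((joint n \<beta> (S k) x - joint n \<beta> 0 x) / S k)" for k x
    have Sk: "S k \<in> {0..1/20}" for k
      using S(1)[of k] S(2)[of k] by auto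
    have S0: "filterlim S (at_right 0) sequentially"
      unfolding filterlim_at using S(3) by (auto intro!: always_eventually simp: S(1) less_imp_neq[OF S(1), symmetric])
    have lim: "(\<lambda>k. q k x) \<longlonglongrightarrow> indicator R x * (sample_score n \<beta> x * joint n \<beta> 0 x)" for x
      unfolding q_def by (intro tendsto_intros filterlim_compose[OF joint_right_derivative[OF assms] S0])
    have bound: "norm (q k x) \<le> real n * w x" for k x
    proof -
      have w0: "w x > 0"
        unfolding w_def by (intro prod_pos) (simp add: pos)
      have "\<bar>joint n \<beta> (S k) x - joint n \<beta> 0 x\<bar> / S k \<le> (real n * S k * w x) / S k"
        using S(1)[of k] by (intro divide_right_mono lip Sk) auto
      also have "\<dots> = real n * w x"
        using S(1)[of k] by simp
      finally show ?thesis
        using S(1)[of k] w0 by (auto simp: q_def abs_mult indicator_def)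
    qed
    have [measurable]: "q k \<in> borel_measurable (lebesgue_n n)" for k
      unfolding q_def by measurable
    have int: "integrable (lebesgue_n n) (\<lambda>x. real n * w x)"
      using w by simp
    have "integrable (lebesgue_n n) (\<lambda>x. indicator R x * (sample_score n \<beta> x * joint n \<beta> 0 x))"
      by (rule integrable_dominated_convergence[where s = q, OF _ _ int]) (use lim bound in auto)
    moreover have "(\<lambda>k. LINT x|lebesgue_n n. q k x) \<longlonglongrightarrow>
        (LINT x|lebesgue_n n. indicator R x * (sample_score n \<beta> x * joint n \<beta> 0 x))"
      by (rule integral_dominated_convergence[OF _ _ int]) (use lim bound in auto)
    moreover have "(LINT x|lebesgue_n n. q k x) = ((LINT x|lebesgue_n n. indicator R x * joint n \<beta> (S k) x) -
          (LINT x|lebesgue_n n. indicator R x * joint n \<beta> 0 x)) / S k" for k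
    proof -
      have ind: "integrable (lebesgue_n n) (\<lambda>x. indicator R x * joint n \<beta> \<theta> x)" if "\<theta> \<in> {0..1/20}" for \<theta>
        using integrable_mult_indicator[OF R joint[OF that]] by simp
      have "(LINT x|lebesgue_n n. q k x) =
          (LINT x|lebesgue_n n. (indicator R x * joint n \<beta> (S k) x - indicator R x * joint n \<beta> 0 x) / S k)"
        by (simp add: q_def right_diff_distrib)
      then show ?thesis
        using ind[OF Sk] ind[of 0] by simp
    qed
    ultimately show ?thesis
      by simp
  qed
  have "integrable (lebesgue_n n) (\<lambda>x. indicator (space (lebesgue_n n)) x * (sample_score n \<beta> x * joint n \<beta> 0 x))"
    using main[of "space (lebesgue_n n)" "\<lambda>k. 1 / real (k + 21)"]
      LIMSEQ_ignore_initial_segment[OF lim_1_over_n, of 21] by (auto simp: divide_simps)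
  then show "integrable (lebesgue_n n) (\<lambda>x. sample_score n \<beta> x * joint n \<beta> 0 x)"
    by (rule Bochner_Integration.integrable_cong[THEN iffD1, rotated -1]) auto
  show "((\<lambda>\<theta>. ((LINT x|lebesgue_n n. indicator S x * joint n \<beta> \<theta> x) -
              (LINT x|lebesgue_n n. indicator S x * joint n \<beta> 0 x)) / \<theta>)
          \<longlongrightarrow> (LINT x|lebesgue_n n. indicator S x * (sample_score n \<beta> x * joint n \<beta> 0 x))) (at_right 0)"
    if "S \<in> sets (lebesgue_n n)" for S
    by (rule tendsto_at_right_sequentially[of _ "1 / 20"]) (use main[OF that] in auto)
qed

lemma measure_stable_sample:
  assumes "\<bar>\<beta>\<bar> \<le> 1" "\<theta> \<in> {0..1/20}" and S [measurable]: "S \<in> sets (lebesgue_n n)"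
  shows "measure (stable_sample n \<beta> 0 1 \<theta>) S = (LINT x|lebesgue_n n. indicator S x * joint n \<beta> \<theta> x)"
proof -
  have int: "integrable (lebesgue_n n) (\<lambda>x. indicator S x * joint n \<beta> \<theta> x)"
    using integrable_mult_indicator[OF S integrable_joint[OF assms(1,2)]] by simp
  have "emeasure (stable_sample n \<beta> 0 1 \<theta>) S = (\<integral>\<^sup>+x. ennreal (joint n \<beta> \<theta> x) * indicator S x \<partial>lebesgue_n n)"
    unfolding stable_sample_eq_density by (intro emeasure_density) measurable
  also have "\<dots> = (\<integral>\<^sup>+x. ennreal (indicator S x * joint n \<beta> \<theta> x) \<partial>lebesgue_n n)"
    by (intro nn_integral_cong) (auto simp: indicator_def)
  also have "\<dots> = ennreal (LINT x|lebesgue_n n. indicator S x * joint n \<beta> \<theta> x)"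
    by (intro nn_integral_eq_integral int) auto
  finally show ?thesis
    by (simp add: measure_def integral_nonneg_AE)
qed

section \<open>Affine images and standardization\<close>

lemma measurable_affine_sample [measurable (raw)]:
  assumes "f \<in> borel_measurable N" "g \<in> borel_measurable N"
    "\<And>i. i \<in> {..<n} \<Longrightarrow> (\<lambda>p. h p i) \<in> borel_measurable N"
  shows "(\<lambda>p. affine_sample n (f p) (g p) (h p)) \<in> measurable N (lebesgue_n n)"
  unfolding affine_sample_def using assms by (intro measurable_restrict) simp

lemma measurable_sample_mean [measurable (raw)]:
  assumes "\<And>i. i \<in> {..<n} \<Longrightarrow> (\<lambda>p. h p i) \<in> borel_measurable N"
  shows "(\<lambda>p. sample_mean n (h p)) \<in> borel_measurable N"
  unfolding sample_mean_def using assms by measurable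

lemma measurable_sample_sd [measurable (raw)]:
  assumes "\<And>i. i \<in> {..<n} \<Longrightarrow> (\<lambda>p. h p i) \<in> borel_measurable N"
  shows "(\<lambda>p. sample_sd n (h p)) \<in> borel_measurable N"
proof -
  note assms[measurable]
  show ?thesis
    unfolding sample_sd_def by measurable
qed

lemma measurable_standardize [measurable (raw)]:
  assumes "\<And>i. i \<in> {..<n} \<Longrightarrow> (\<lambda>p. h p i) \<in> borel_measurable N" "j \<in> {..<n}"
  shows "(\<lambda>p. standardize n (h p) j) \<in> borel_measurable N"
proof -
  note assms[measurable]
  show ?thesis
    unfolding standardize_def by measurable
qed

lemma affine_sample_apply: "i < n \<Longrightarrow> affine_sample n a b x i = a + b * x i"
  by (simp add: affine_sample_def)

lemma sample_mean_affine:
  "n > 0 \<Longrightarrow> sample_mean n (affine_sample n u v x) = u + v * sample_mean n x"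
  by (simp add: sample_mean_def affine_sample_def sum.distrib sum_distrib_left[symmetric] field_simps)

lemma sample_sd_affine:
  assumes "n > 0" "v > 0"
  shows "sample_sd n (affine_sample n u v x) = v * sample_sd n x"
proof -
  have "(\<Sum>j<n. (affine_sample n u v x j - sample_mean n (affine_sample n u v x))\<^sup>2) =
      (\<Sum>j<n. v\<^sup>2 * (x j - sample_mean n x)\<^sup>2)"
    unfolding sample_mean_affine[OF assms(1)]
    by (intro sum.cong refl) (simp add: affine_sample_def power2_eq_square algebra_simps)
  also have "\<dots> = v\<^sup>2 * (\<Sum>j<n. (x j - sample_mean n x)\<^sup>2)"
    by (simp add: sum_distrib_left)
  finally show ?thesis
    using assms(2) by (simp add: sample_sd_def real_sqrt_mult mult.left_commute[of _ "v\<^sup>2"] flip: times_divide_eq_right)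
qed

lemma sample_sd_nonneg [simp]: "sample_sd n x \<ge> 0"
  by (simp add: sample_sd_def sum_nonneg)

lemma standardize_affine:
  assumes "n > 0" "b > 0" "i < n"
  shows "standardize n (affine_sample n a b x) i = standardize n x i"
  using assms
  by (simp add: standardize_def sample_mean_affine sample_sd_affine affine_sample_apply flip: right_diff_distrib)

text \<open>
  This makes the normal density a function of sample mean and standard deviation only, and the
  affine group acts on these two in a simple way.
\<close>

lemma sum_squares_eq:
  assumes "n > 0"
  shows "(\<Sum>i<n. (x i)\<^sup>2) = real n * ((sample_mean n x)\<^sup>2 + (sample_sd n x)\<^sup>2)"
proof -
  have S: "(\<Sum>i<n. x i) = real n * sample_mean n x"
    using assms by (simp add: sample_mean_def)
  have "(sample_sd n x)\<^sup>2 = 1 / real n * (\<Sum>j<n. (x j - sample_mean n x)\<^sup>2)"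
    unfolding sample_sd_def by (intro real_sqrt_pow2) (simp add: sum_nonneg)
  then have "real n * (sample_sd n x)\<^sup>2 = (\<Sum>j<n. (x j - sample_mean n x)\<^sup>2)"
    using assms by simp
  also have "\<dots> = (\<Sum>j<n. (x j)\<^sup>2) - 2 * sample_mean n x * (\<Sum>j<n. x j) + real n * (sample_mean n x)\<^sup>2"
    by (simp add: power2_diff sum.distrib sum_subtractf sum_distrib_left mult_ac)
  finally show ?thesis
    unfolding S by (simp add: power2_eq_square algebra_simps)
qed

definition gauss_weight :: "nat \<Rightarrow> (nat \<Rightarrow> real) \<Rightarrow> real" where
  "gauss_weight n x = exp (- (\<Sum>i<n. (x i)\<^sup>2) / 4)"

lemma measurable_gauss_weight [measurable (raw)]:
  assumes "\<And>i. i \<in> {..<n} \<Longrightarrow> (\<lambda>p. h p i) \<in> borel_measurable N"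
  shows "(\<lambda>p. gauss_weight n (h p)) \<in> borel_measurable N"
proof -
  note assms[measurable]
  show ?thesis
    unfolding gauss_weight_def by measurable
qed

lemma gauss_weight_pos [simp]: "gauss_weight n x > 0" "gauss_weight n x \<ge> 0"
  by (simp_all add: gauss_weight_def)

lemma joint_0_eq: "joint n \<beta> 0 x = (1 / (2 * sqrt pi)) ^ n * gauss_weight n x"
proof -
  have "max 0 (std_density \<beta> y 0) = 1 / (2 * sqrt pi) * exp (- (y\<^sup>2 / 4))" for y
    using std_density_0_pos[of \<beta> y] unfolding std_density_0 by simp
  then show ?thesis
    by (simp add: joint_def gauss_weight_def prod.distrib exp_sum[symmetric] prod_dividef
        power_divide sum_divide_distrib sum_negf)
qed

lemma emeasure_lborel_affine:
  assumes "v > 0" and [measurable]: "A \<in> sets borel"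
  shows "emeasure lborel A = ennreal v * emeasure lborel {x. u + v * x \<in> A}"
proof -
  have [measurable]: "{x. u + v * x \<in> A} \<in> sets borel"
    by measurable
  have "emeasure lborel A = (\<integral>\<^sup>+x. indicator A x \<partial>lborel)"
    by simp
  also have "\<dots> = ennreal \<bar>v\<bar> * (\<integral>\<^sup>+x. indicator A (u + v * x) \<partial>lborel)"
    using assms(1) by (intro nn_integral_real_affine) auto
  also have "(\<integral>\<^sup>+x. indicator A (u + v * x) \<partial>lborel) = (\<integral>\<^sup>+x. indicator {x. u + v * x \<in> A} x \<partial>lborel)"
    by (intro nn_integral_cong) (simp add: indicator_def)
  finally show ?thesis
    using assms(1) by simp
qed

lemma nn_integral_affine_sample:
  assumes v: "v > 0" and H: "H \<in> borel_measurable (lebesgue_n n)"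
  shows "(\<integral>\<^sup>+x. H x \<partial>lebesgue_n n) = ennreal (v ^ n) * (\<integral>\<^sup>+x. H (affine_sample n u v x) \<partial>lebesgue_n n)"
proof -
  let ?T = "affine_sample n u v"
  have T [measurable]: "?T \<in> measurable (lebesgue_n n) (lebesgue_n n)"
    by measurable
  have "density (distr (lebesgue_n n) (lebesgue_n n) ?T) (\<lambda>_. ennreal (v ^ n)) = lebesgue_n n"
  proof (rule lborel_product.PiM_eqI)
    fix A :: "nat \<Rightarrow> real set"
    assume A: "\<And>i. i \<in> {..<n} \<Longrightarrow> A i \<in> sets lborel"
    then have box: "Pi\<^sub>E {..<n} A \<in> sets (lebesgue_n n)"
      by (intro sets_PiM_I_finite) auto
    have A': "{x. u + v * x \<in> A i} \<in> sets lborel" if "i \<in> {..<n}" for i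
    proof -
      have [measurable]: "A i \<in> sets borel"
        using A[OF that] by simp
      show ?thesis
        by measurable
    qed
    have "?T -` Pi\<^sub>E {..<n} A \<inter> space (lebesgue_n n) = Pi\<^sub>E {..<n} (\<lambda>i. {x. u + v * x \<in> A i})"
    proof (rule set_eqI)
      fix x :: "nat \<Rightarrow> real"
      have "x \<in> ?T -` Pi\<^sub>E {..<n} A \<inter> space (lebesgue_n n) \<longleftrightarrow>
          (\<forall>i\<in>{..<n}. u + v * x i \<in> A i) \<and> x \<in> extensional {..<n}"
        unfolding Int_iff vimage_eq affine_sample_def restrict_PiE_iff
        by (simp add: space_PiM PiE_iff)
      then show "x \<in> ?T -` Pi\<^sub>E {..<n} A \<inter> space (lebesgue_n n) \<longleftrightarrow>
          x \<in> Pi\<^sub>E {..<n} (\<lambda>i. {x. u + v * x \<in> A i})"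
        by (simp only: PiE_iff mem_Collect_eq)
    qed
    then have "emeasure (density (distr (lebesgue_n n) (lebesgue_n n) ?T) (\<lambda>_. ennreal (v ^ n))) (Pi\<^sub>E {..<n} A) =
        ennreal (v ^ n) * emeasure (lebesgue_n n) (Pi\<^sub>E {..<n} (\<lambda>i. {x. u + v * x \<in> A i}))"
      using box by (simp add: emeasure_density_const emeasure_distr[OF T])
    also have "\<dots> = ennreal (v ^ n) * (\<Prod>i<n. emeasure lborel {x. u + v * x \<in> A i})"
      using A' by (subst lborel_product.emeasure_PiM) auto
    also have "\<dots> = (\<Prod>i<n. ennreal v * emeasure lborel {x. u + v * x \<in> A i})"
      using v by (simp add: prod.distrib ennreal_power)
    also have "\<dots> = (\<Prod>i<n. emeasure lborel (A i))"
      using A by (intro prod.cong refl emeasure_lborel_affine[symmetric] v) auto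
    finally show "emeasure (density (distr (lebesgue_n n) (lebesgue_n n) ?T) (\<lambda>_. ennreal (v ^ n))) (Pi\<^sub>E {..<n} A) =
        (\<Prod>i<n. emeasure lborel (A i))" .
  qed auto
  then have "(\<integral>\<^sup>+x. H x \<partial>lebesgue_n n) =
      (\<integral>\<^sup>+x. H x \<partial>density (distr (lebesgue_n n) (lebesgue_n n) ?T) (\<lambda>_. ennreal (v ^ n)))"
    by simp
  also have "\<dots> = ennreal (v ^ n) * (\<integral>\<^sup>+x. H (?T x) \<partial>lebesgue_n n)"
    using H by (simp add: nn_integral_density nn_integral_cmult nn_integral_distr[OF T])
  finally show ?thesis .
qed

text \<open>
  The standard deviation vanishes only if all observations are equal, in particular the first two;
  integrating over the first coordinate shows that this has measure zero.
\<close>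

lemma AE_sample_sd_pos:
  assumes n: "n \<ge> 2"
  shows "AE x in lebesgue_n n. sample_sd n x > 0"
proof -
  let ?N = "{x \<in> space (lebesgue_n n). x 0 = x 1}"
  have [measurable]: "(\<lambda>x. x 0) \<in> borel_measurable (lebesgue_n n)" "(\<lambda>x. x 1) \<in> borel_measurable (lebesgue_n n)"
    using n measurable_component_singleton[of 0 "{..<n}" "\<lambda>_. lborel"]
      measurable_component_singleton[of 1 "{..<n}" "\<lambda>_. lborel"] by simp_all
  have N [measurable]: "?N \<in> sets (lebesgue_n n)"
    by measurable
  have ins: "{..<n} = insert 0 {1..<n}"
    using n by auto
  have "emeasure (lebesgue_n n) ?N = (\<integral>\<^sup>+x. indicator ?N x \<partial>lebesgue_n n)"
    using N by simp
  also have "\<dots> = (\<integral>\<^sup>+x. (\<integral>\<^sup>+y. indicator ?N (x(0 := y)) \<partial>lborel) \<partial>PiM {1..<n} (\<lambda>_. lborel))"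
    using N unfolding ins by (intro lborel_product.product_nn_integral_insert) auto
  also have "\<dots> \<le> (\<integral>\<^sup>+x. (\<integral>\<^sup>+y. indicator {x 1 :: real} y \<partial>lborel) \<partial>PiM {1..<n} (\<lambda>_. lborel))"
    by (intro nn_integral_mono) (auto simp: indicator_def)
  also have "\<dots> = 0"
    by simp
  finally have "?N \<in> null_sets (lebesgue_n n)"
    using N by (auto simp: null_sets_def)
  then have "AE x in lebesgue_n n. x \<notin> ?N"
    by (rule AE_not_in)
  then show ?thesis
  proof (rule AE_mp, intro AE_I2 impI)
    fix x assume "x \<in> space (lebesgue_n n)" "x \<notin> ?N"
    then have "x 0 \<noteq> x 1"
      by simp
    then have "\<exists>i<n. x i - sample_mean n x \<noteq> 0"
      using n by (metis eq_iff_diff_eq_0 less_le_trans one_less_numeral_iff pos2 semiring_norm(76))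
    then obtain i where i: "i < n" "x i - sample_mean n x \<noteq> 0"
      by blast
    then have "0 < (x i - sample_mean n x)\<^sup>2"
      by simp
    also have "\<dots> \<le> (\<Sum>j<n. (x j - sample_mean n x)\<^sup>2)"
      using i by (intro member_le_sum) auto
    finally show "sample_sd n x > 0"
      using n by (simp add: sample_sd_def)
  qed
qed

section \<open>Averaging over the orbits of the affine group\<close>

text \<open>
  The constant of \<open>orbit_average\<close>, in the form in which it first appears: the integral over the
  affine group that \<open>orbit_const_shift\<close> shows to be the same for every nondegenerate sample.
\<close>

definition orbit_const :: "nat \<Rightarrow> ennreal" where
  "orbit_const n = (\<integral>\<^sup>+v. \<integral>\<^sup>+u. indicator {0<..} v *
     ennreal (1 / v\<^sup>2 * (exp (- (real n * ((u / v)\<^sup>2 + (1 / v)\<^sup>2) / 4)) * (1 / v) ^ (n - 1))) \<partial>lborel \<partial>lborel)"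

lemma gauss_weight_eq:
  assumes "n > 0"
  shows "gauss_weight n x = exp (- (real n * ((sample_mean n x)\<^sup>2 + (sample_sd n x)\<^sup>2) / 4))"
  unfolding gauss_weight_def sum_squares_eq[OF assms] by simp

text \<open>
  The integral over \<open>(u, v)\<close> is invariant under the substitution \<open>u \<rightarrow> m + s u\<close>, \<open>v \<rightarrow> s v\<close>, which
  moves a sample with mean \<open>m\<close> and standard deviation \<open>s\<close> to mean 0 and standard deviation 1: the
  Jacobian \<open>s\<^sup>2\<close> cancels against the weight \<open>1 / v\<^sup>2\<close>. In other words, \<open>du dv / v\<^sup>2\<close> is a Haar measure.
\<close>

lemma orbit_const_shift:
  assumes "n > 0" and s: "sample_sd n x > 0"
  shows "(\<integral>\<^sup>+v. \<integral>\<^sup>+u. indicator {0<..} v * ennreal (1 / v\<^sup>2 *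
      (gauss_weight n (affine_sample n (- u / v) (1 / v) x) *
       sample_sd n (affine_sample n (- u / v) (1 / v) x) ^ (n - 1))) \<partial>lborel \<partial>lborel) = orbit_const n"
proof -
  define m where "m = sample_mean n x"
  define s where "s = sample_sd n x"
  have s: "s > 0"
    using assms by (simp add: s_def)
  define F where "F v u = indicator {0<..} v * ennreal (1 / v\<^sup>2 *
      (exp (- (real n * (((m - u) / v)\<^sup>2 + (s / v)\<^sup>2) / 4)) * (s / v) ^ (n - 1)))" for v u :: real
  have F: "indicator {0<..} v * ennreal (1 / v\<^sup>2 *
      (gauss_weight n (affine_sample n (- u / v) (1 / v) x) *
       sample_sd n (affine_sample n (- u / v) (1 / v) x) ^ (n - 1))) = F v u" for v u
  proof (cases "v > 0")
    case True
    then have "sample_mean n (affine_sample n (- u / v) (1 / v) x) = (m - u) / v"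
      "sample_sd n (affine_sample n (- u / v) (1 / v) x) = s / v"
      using assms(1) by (simp_all add: sample_mean_affine sample_sd_affine m_def s_def field_simps)
    then show ?thesis
      unfolding gauss_weight_eq[OF assms(1)] F_def by simp
  qed (simp add: F_def)
  have [measurable]: "case_prod F \<in> borel_measurable (lborel \<Otimes>\<^sub>M lborel)"
    unfolding F_def by measurable
  have "(\<integral>\<^sup>+v. \<integral>\<^sup>+u. F v u \<partial>lborel \<partial>lborel) =
      ennreal \<bar>s\<bar> * (\<integral>\<^sup>+v. \<integral>\<^sup>+u. F (0 + s * v) u \<partial>lborel \<partial>lborel)"
    using s by (intro nn_integral_real_affine) auto
  also have "\<dots> = ennreal \<bar>s\<bar> * (\<integral>\<^sup>+v. ennreal \<bar>s\<bar> * (\<integral>\<^sup>+u. F (0 + s * v) (m + s * u) \<partial>lborel) \<partial>lborel)"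
    using s by (intro arg_cong2[where f = "(*)"] nn_integral_cong nn_integral_real_affine refl) auto
  also have "\<dots> = (\<integral>\<^sup>+v. \<integral>\<^sup>+u. ennreal \<bar>s\<bar> * (ennreal \<bar>s\<bar> * F (0 + s * v) (m + s * u)) \<partial>lborel \<partial>lborel)"
    by (simp add: nn_integral_cmult)
  also have "\<dots> = orbit_const n"
    unfolding orbit_const_def
  proof (intro nn_integral_cong)
    fix v u :: real
    show "ennreal \<bar>s\<bar> * (ennreal \<bar>s\<bar> * F (0 + s * v) (m + s * u)) = indicator {0<..} v *
      ennreal (1 / v\<^sup>2 * (exp (- (real n * ((u / v)\<^sup>2 + (1 / v)\<^sup>2) / 4)) * (1 / v) ^ (n - 1)))"
    proof (cases "v > 0")
      case True
      have "(m - (m + s * u)) / (s * v) = - (u / v)" "s / (s * v) = 1 / v"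
        using s True by (simp_all add: field_simps)
      then have "F (0 + s * v) (m + s * u) =
          ennreal (1 / (s * v)\<^sup>2 * (exp (- (real n * ((u / v)\<^sup>2 + (1 / v)\<^sup>2) / 4)) * (1 / v) ^ (n - 1)))"
        using s True by (simp add: F_def)
      moreover have "s * (s * (1 / (s * v)\<^sup>2 * E)) = 1 / v\<^sup>2 * E" for E
        using s True by (simp add: power2_eq_square)
      ultimately show ?thesis
        using s True by (simp flip: ennreal_mult')
    next
      case False
      then have "\<not> s * v > 0"
        using s by (simp add: zero_less_mult_iff)
      then show ?thesis
        using False by (simp add: F_def)
    qed
  qed
  finally show ?thesis
    unfolding F .
qed

text \<open>
  The substitution \<open>a = u + v m\<close>, \<open>b = s v\<close> replaces the standardized sample by the sample itself. It
  contributes \<open>s\<close> from the measure and \<open>s\<^bsup>n-2\<^esup>\<close> from the weight.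
\<close>

lemma orbit_integral_standardize:
  assumes n: "n \<ge> 2" and H [measurable]: "H \<in> borel_measurable (lebesgue_n n)"
    and s: "sample_sd n y > 0"
  shows "(\<integral>\<^sup>+b. \<integral>\<^sup>+a. indicator {0<..} b * (ennreal (b ^ (n - 2)) *
        H (affine_sample n a b (standardize n y))) \<partial>lborel \<partial>lborel) =
    ennreal (sample_sd n y ^ (n - 1)) *
      (\<integral>\<^sup>+v. \<integral>\<^sup>+u. indicator {0<..} v * (ennreal (v ^ (n - 2)) * H (affine_sample n u v y)) \<partial>lborel \<partial>lborel)"
proof -
  define m where "m = sample_mean n y"
  define s where "s = sample_sd n y"
  have s: "s > 0"
    using assms by (simp add: s_def)
  define F where "F b a = indicator {0<..} b * (ennreal (b ^ (n - 2)) *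
        H (affine_sample n a b (standardize n y)))" for b a :: real
  have [measurable]: "case_prod F \<in> borel_measurable (lborel \<Otimes>\<^sub>M lborel)"
    unfolding F_def by measurable
  have [measurable]: "(\<lambda>(v, u). H (affine_sample n u v y)) \<in> borel_measurable (lborel \<Otimes>\<^sub>M lborel)"
    by measurable
  have "(\<integral>\<^sup>+b. \<integral>\<^sup>+a. F b a \<partial>lborel \<partial>lborel) =
      ennreal \<bar>s\<bar> * (\<integral>\<^sup>+v. \<integral>\<^sup>+a. F (0 + s * v) a \<partial>lborel \<partial>lborel)"
    using s by (intro nn_integral_real_affine) auto
  also have "\<dots> = ennreal \<bar>s\<bar> * (\<integral>\<^sup>+v. ennreal \<bar>1\<bar> * (\<integral>\<^sup>+u. F (0 + s * v) (v * m + 1 * u) \<partial>lborel) \<partial>lborel)"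
    using s by (intro arg_cong2[where f = "(*)"] nn_integral_cong nn_integral_real_affine refl) auto
  also have "\<dots> = (\<integral>\<^sup>+v. \<integral>\<^sup>+u. ennreal \<bar>s\<bar> * F (0 + s * v) (v * m + 1 * u) \<partial>lborel \<partial>lborel)"
    by (simp add: nn_integral_cmult)
  also have "\<dots> = (\<integral>\<^sup>+v. \<integral>\<^sup>+u. ennreal (s ^ (n - 1)) *
      (indicator {0<..} v * (ennreal (v ^ (n - 2)) * H (affine_sample n u v y))) \<partial>lborel \<partial>lborel)"
  proof (intro nn_integral_cong)
    fix v u :: real
    show "ennreal \<bar>s\<bar> * F (0 + s * v) (v * m + 1 * u) = ennreal (s ^ (n - 1)) *
      (indicator {0<..} v * (ennreal (v ^ (n - 2)) * H (affine_sample n u v y)))"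
    proof (cases "v > 0")
      case True
      have "affine_sample n (v * m + 1 * u) (0 + s * v) (standardize n y) = affine_sample n u v y"
        using s unfolding affine_sample_def standardize_def m_def[symmetric] s_def[symmetric]
        by (intro restrict_ext) (simp add: field_simps)
      moreover have "s * (s * v) ^ (n - 2) = s ^ (n - 1) * v ^ (n - 2)"
      proof -
        have "n - 1 = Suc (n - 2)"
          using n by simp
        then show ?thesis
          by (simp add: power_mult_distrib)
      qed
      then have "ennreal s * ennreal ((s * v) ^ (n - 2)) = ennreal (s ^ (n - 1)) * ennreal (v ^ (n - 2))"
        using s True by (simp flip: ennreal_mult')
      ultimately show ?thesis
        using s True unfolding F_def by (simp flip: mult.assoc)
    next
      case False
      then have "\<not> s * v > 0"
        using s by (simp add: zero_less_mult_iff)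
      then show ?thesis
        using False by (simp add: F_def)
    qed
  qed
  also have "\<dots> = ennreal (s ^ (n - 1)) *
      (\<integral>\<^sup>+v. \<integral>\<^sup>+u. indicator {0<..} v * (ennreal (v ^ (n - 2)) * H (affine_sample n u v y)) \<partial>lborel \<partial>lborel)"
    by (simp add: nn_integral_cmult)
  finally show ?thesis
    unfolding F_def s_def .
qed

lemma affine_sample_inverse:
  assumes "x \<in> space (lebesgue_n n)" "v > 0"
  shows "affine_sample n (- u / v) (1 / v) (affine_sample n u v x) = x"
proof
  fix i
  show "affine_sample n (- u / v) (1 / v) (affine_sample n u v x) i = x i"
  proof (cases "i < n")
    case True
    then show ?thesis
      using assms(2) by (simp add: affine_sample_apply add_divide_distrib)
  next
    case False
    then have "x i = undefined"
      using assms(1) by (auto simp: space_PiM intro: PiE_arb)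
    then show ?thesis
      using False by (simp add: affine_sample_def)
  qed
qed

text \<open>
  Exchange the order of integration so that the integral over the sample comes first, substitute
  \<open>x = u + v y\<close> in it, and exchange back. The substitution takes \<open>v\<^bsup>n-2\<^esup> dy\<close> to \<open>v\<^bsup>-2\<^esup> dx\<close>, and what
  is then integrated over \<open>(u, v)\<close> is the integrand of \<open>orbit_const_shift\<close> times \<open>H x\<close>.
\<close>

proposition orbit_average:
  assumes n: "n \<ge> 2" and H [measurable]: "H \<in> borel_measurable (lebesgue_n n)"
  shows "orbit_const n * (\<integral>\<^sup>+x. H x \<partial>lebesgue_n n) =
    (\<integral>\<^sup>+y. ennreal (gauss_weight n y) *
      (\<integral>\<^sup>+b. \<integral>\<^sup>+a. indicator {0<..} b * (ennreal (b ^ (n - 2)) *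
        H (affine_sample n a b (standardize n y))) \<partial>lborel \<partial>lborel) \<partial>lebesgue_n n)" (is "_ = ?R")
proof -
  interpret M: sigma_finite_measure "lebesgue_n n"
    by (rule lborel_product.sigma_finite) simp
  interpret P: pair_sigma_finite "lborel :: real measure" "lebesgue_n n" ..
  define W where "W y = ennreal (gauss_weight n y * sample_sd n y ^ (n - 1))" for y
  have W [measurable]: "W \<in> borel_measurable (lebesgue_n n)"
    unfolding W_def by measurable
  let ?G = "\<lambda>v u y. W y * (indicator {0<..} v * (ennreal (v ^ (n - 2)) * H (affine_sample n u v y)))"
  let ?G' = "\<lambda>v u x. indicator {0<..} v * ennreal (1 / v\<^sup>2) * W (affine_sample n (- u / v) (1 / v) x) * H x"
  have "?R = (\<integral>\<^sup>+y. W y *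
      (\<integral>\<^sup>+v. \<integral>\<^sup>+u. indicator {0<..} v * (ennreal (v ^ (n - 2)) * H (affine_sample n u v y)) \<partial>lborel \<partial>lborel)
      \<partial>lebesgue_n n)"
  proof (rule nn_integral_cong_AE, rule AE_mp[OF AE_sample_sd_pos[OF n]], intro AE_I2 impI)
    fix y assume "sample_sd n y > 0"
    from orbit_integral_standardize[OF n H this]
    show "ennreal (gauss_weight n y) *
      (\<integral>\<^sup>+b. \<integral>\<^sup>+a. indicator {0<..} b * (ennreal (b ^ (n - 2)) *
        H (affine_sample n a b (standardize n y))) \<partial>lborel \<partial>lborel) = W y *
      (\<integral>\<^sup>+v. \<integral>\<^sup>+u. indicator {0<..} v * (ennreal (v ^ (n - 2)) * H (affine_sample n u v y)) \<partial>lborel \<partial>lborel)"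
      by (simp add: W_def ennreal_mult' mult.assoc)
  qed
  also have "\<dots> = (\<integral>\<^sup>+y. \<integral>\<^sup>+v. \<integral>\<^sup>+u. ?G v u y \<partial>lborel \<partial>lborel \<partial>lebesgue_n n)"
  proof (rule nn_integral_cong)
    fix y assume "y \<in> space (lebesgue_n n)"
    have [measurable]: "(\<lambda>(v, u). H (affine_sample n u v y)) \<in> borel_measurable (lborel \<Otimes>\<^sub>M lborel)"
      by measurable
    show "W y * (\<integral>\<^sup>+v. \<integral>\<^sup>+u. indicator {0<..} v * (ennreal (v ^ (n - 2)) * H (affine_sample n u v y)) \<partial>lborel \<partial>lborel) =
        (\<integral>\<^sup>+v. \<integral>\<^sup>+u. ?G v u y \<partial>lborel \<partial>lborel)"
      by (simp add: nn_integral_cmult)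
  qed
  also have "\<dots> = (\<integral>\<^sup>+v. \<integral>\<^sup>+y. \<integral>\<^sup>+u. ?G v u y \<partial>lborel \<partial>lebesgue_n n \<partial>lborel)"
    by (rule P.Fubini') measurable
  also have "\<dots> = (\<integral>\<^sup>+v. \<integral>\<^sup>+u. \<integral>\<^sup>+y. ?G v u y \<partial>lebesgue_n n \<partial>lborel \<partial>lborel)"
    by (intro nn_integral_cong P.Fubini') measurable
  also have "\<dots> = (\<integral>\<^sup>+v. \<integral>\<^sup>+u. \<integral>\<^sup>+x. ?G' v u x \<partial>lebesgue_n n \<partial>lborel \<partial>lborel)"
  proof (rule nn_integral_cong, rule nn_integral_cong)
    fix v u :: real
    show "(\<integral>\<^sup>+y. ?G v u y \<partial>lebesgue_n n) = (\<integral>\<^sup>+x. ?G' v u x \<partial>lebesgue_n n)"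
    proof (cases "v > 0")
      case True
      have "(\<integral>\<^sup>+x. ?G' v u x \<partial>lebesgue_n n) =
          ennreal (v ^ n) * (\<integral>\<^sup>+y. ?G' v u (affine_sample n u v y) \<partial>lebesgue_n n)"
        using True by (intro nn_integral_affine_sample) measurable
      also have "\<dots> = (\<integral>\<^sup>+y. ennreal (v ^ n) * ?G' v u (affine_sample n u v y) \<partial>lebesgue_n n)"
      proof (intro nn_integral_cmult[symmetric])
        have "(\<lambda>x. ?G' v u x) \<in> borel_measurable (lebesgue_n n)"
          by measurable
        moreover have "affine_sample n u v \<in> measurable (lebesgue_n n) (lebesgue_n n)"
          by measurable
        ultimately show "(\<lambda>y. ?G' v u (affine_sample n u v y)) \<in> borel_measurable (lebesgue_n n)"
          by (rule measurable_compose[rotated])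
      qed
      also have "\<dots> = (\<integral>\<^sup>+y. ?G v u y \<partial>lebesgue_n n)"
      proof (rule nn_integral_cong)
        fix y assume y: "y \<in> space (lebesgue_n n)"
        have "v ^ n * (1 / v\<^sup>2) = v ^ (n - 2)"
          using True n by (simp add: power_diff)
        then have eq: "ennreal (v ^ n) * ennreal (1 / v\<^sup>2) = ennreal (v ^ (n - 2))"
          using True by (simp flip: ennreal_mult')
        have "ennreal (v ^ n) * ?G' v u (affine_sample n u v y) =
            (ennreal (v ^ n) * ennreal (1 / v\<^sup>2)) * (W y * H (affine_sample n u v y))"
          using True unfolding affine_sample_inverse[OF y True] by (simp add: mult_ac)
        also have "\<dots> = ?G v u y"
          using True unfolding eq by (simp add: mult_ac)
        finally show "ennreal (v ^ n) * ?G' v u (affine_sample n u v y) = ?G v u y" .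
      qed
      finally show ?thesis ..
    next
      case False
      then have "indicator {0<..} v = (0 :: ennreal)"
        by simp
      then show ?thesis
        by simp
    qed
  qed
  also have "\<dots> = (\<integral>\<^sup>+v. \<integral>\<^sup>+x. \<integral>\<^sup>+u. ?G' v u x \<partial>lborel \<partial>lebesgue_n n \<partial>lborel)"
    by (intro nn_integral_cong P.Fubini'[symmetric]) measurable
  also have "\<dots> = (\<integral>\<^sup>+x. \<integral>\<^sup>+v. \<integral>\<^sup>+u. ?G' v u x \<partial>lborel \<partial>lborel \<partial>lebesgue_n n)"
    by (rule P.Fubini'[symmetric]) measurable
  also have "\<dots> = (\<integral>\<^sup>+x. orbit_const n * H x \<partial>lebesgue_n n)"
  proof (rule nn_integral_cong_AE, rule AE_mp[OF AE_sample_sd_pos[OF n]], intro AE_I2 impI)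
    fix x assume x: "x \<in> space (lebesgue_n n)" "sample_sd n x > 0"
    have [measurable]: "(\<lambda>(v, u). W (affine_sample n (- u / v) (1 / v) x)) \<in> borel_measurable (lborel \<Otimes>\<^sub>M lborel)"
      by measurable
    have "(\<integral>\<^sup>+v. \<integral>\<^sup>+u. ?G' v u x \<partial>lborel \<partial>lborel) = (\<integral>\<^sup>+v. \<integral>\<^sup>+u. indicator {0<..} v *
        ennreal (1 / v\<^sup>2) * W (affine_sample n (- u / v) (1 / v) x) \<partial>lborel \<partial>lborel) * H x"
      by (simp add: nn_integral_multc)
    also have "(\<integral>\<^sup>+v. \<integral>\<^sup>+u. indicator {0<..} v *
        ennreal (1 / v\<^sup>2) * W (affine_sample n (- u / v) (1 / v) x) \<partial>lborel \<partial>lborel) = orbit_const n"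
      unfolding W_def using n x(2)
      by (subst orbit_const_shift[symmetric, of n x]) (auto simp: mult.assoc simp flip: ennreal_mult')
    finally show "(\<integral>\<^sup>+v. \<integral>\<^sup>+u. ?G' v u x \<partial>lborel \<partial>lborel) = orbit_const n * H x" .
  qed
  also have "\<dots> = orbit_const n * (\<integral>\<^sup>+x. H x \<partial>lebesgue_n n)"
    by (intro nn_integral_cmult) measurable
  finally show ?thesis ..
qed

section \<open>The constant of the average is positive and finite\<close>

lemma nn_integral_lborel_neq_0:
  fixes f :: "real \<Rightarrow> ennreal"
  assumes [measurable]: "f \<in> borel_measurable borel" and pos: "\<And>x. x > 0 \<Longrightarrow> f x > 0"
  shows "(\<integral>\<^sup>+x. f x \<partial>lborel) \<noteq> 0"
proof
  assume "(\<integral>\<^sup>+x. f x \<partial>lborel) = 0"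
  then have "AE x in lborel. f x = 0"
    by (subst (asm) nn_integral_0_iff_AE) auto
  then have "AE x in lborel. x \<notin> {0<..<1::real}"
    by eventually_elim (use pos in force)
  then have "emeasure lborel {0<..<1::real} = 0"
    by (subst (asm) AE_iff_null_sets[symmetric]) auto
  then show False
    by simp
qed

lemma nn_integral_gaussian_finite:
  assumes "c > 0"
  shows "(\<integral>\<^sup>+x. ennreal (\<bar>x\<bar> ^ k * exp (- (c * x\<^sup>2))) \<partial>lborel) < \<infinity>"
proof -
  define \<sigma> where "\<sigma> = sqrt (1 / (2 * c))"
  have \<sigma>: "\<sigma> > 0" "2 * \<sigma>\<^sup>2 = 1 / c"
    using assms by (simp_all add: \<sigma>_def)
  have "integrable lborel (\<lambda>x. sqrt (2 * pi * \<sigma>\<^sup>2) * (normal_density 0 \<sigma> x * \<bar>x - 0\<bar> ^ k))"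
    using \<sigma>(1) by (intro integrable_mult_right integrable_normal_moment_abs)
  also have "(\<lambda>x. sqrt (2 * pi * \<sigma>\<^sup>2) * (normal_density 0 \<sigma> x * \<bar>x - 0\<bar> ^ k)) =
      (\<lambda>x. \<bar>x\<bar> ^ k * exp (- (c * x\<^sup>2)))"
    using \<sigma> assms by (auto simp: fun_eq_iff normal_density_def)
  finally show ?thesis
    by (simp add: integrable_iff_bounded)
qed

lemma orbit_affine_standardize:
  assumes "sample_sd n y > 0"
  shows "affine_sample n a b (standardize n y) =
    affine_sample n (a - b / sample_sd n y * sample_mean n y) (b / sample_sd n y) y"
  unfolding affine_sample_def
  by (intro restrict_ext) (simp add: standardize_def diff_divide_distrib algebra_simps)

lemma gauss_weight_orbit:
  assumes "n > 0" "sample_sd n y > 0" "b > 0"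
  shows "gauss_weight n (affine_sample n a b (standardize n y)) = exp (- (real n * (a\<^sup>2 + b\<^sup>2) / 4))"
  using assms
  by (simp add: gauss_weight_eq orbit_affine_standardize sample_mean_affine sample_sd_affine)

lemma nn_integral_gauss_weight:
  "(\<integral>\<^sup>+x. ennreal (gauss_weight n x) \<partial>lebesgue_n n) \<noteq> 0"
  "(\<integral>\<^sup>+x. ennreal (gauss_weight n x) \<partial>lebesgue_n n) < \<infinity>"
proof -
  have eq: "ennreal (gauss_weight n x) = (\<Prod>i<n. ennreal (exp (- ((x i)\<^sup>2 / 4))))" for x
    by (simp add: gauss_weight_def exp_sum[symmetric] prod_ennreal sum_negf sum_divide_distrib)
  have prod: "(\<integral>\<^sup>+x. ennreal (gauss_weight n x) \<partial>lebesgue_n n) =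
      (\<Prod>i<n. \<integral>\<^sup>+x. ennreal (exp (- (x\<^sup>2 / 4))) \<partial>lborel)"
    unfolding eq by (rule lborel_product.product_nn_integral_prod) auto
  have "(\<integral>\<^sup>+x. ennreal (exp (- (x\<^sup>2 / 4))) \<partial>lborel) \<noteq> 0"
    by (rule nn_integral_lborel_neq_0) auto
  then show "(\<integral>\<^sup>+x. ennreal (gauss_weight n x) \<partial>lebesgue_n n) \<noteq> 0"
    unfolding prod by simp
  have "(\<integral>\<^sup>+x. ennreal (exp (- (x\<^sup>2 / 4))) \<partial>lborel) < \<infinity>"
    using nn_integral_gaussian_finite[of "1 / 4" 0] by simp
  then show "(\<integral>\<^sup>+x. ennreal (gauss_weight n x) \<partial>lebesgue_n n) < \<infinity>"
    unfolding prod by (simp add: power_less_top_ennreal)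
qed

text \<open>
  Apply \<open>orbit_average\<close> to the Gaussian weight itself. Its value at \<open>a + b z\<close> is
  \<open>exp (- n (a\<^sup>2 + b\<^sup>2) / 4)\<close>, so the inner integral is a product of two one-dimensional Gaussian
  moments, and all other quantities in the identity are known to be positive and finite.
\<close>

lemma orbit_const_pos_finite:
  assumes n: "n \<ge> 2"
  shows "0 < orbit_const n" "orbit_const n < \<infinity>"
proof -
  define G where "G = (\<integral>\<^sup>+x. ennreal (gauss_weight n x) \<partial>lebesgue_n n)"
  define A where "A = (\<integral>\<^sup>+a. ennreal (exp (- (real n / 4 * a\<^sup>2))) \<partial>lborel)"
  define B where "B = (\<integral>\<^sup>+b. indicator {0<..} b * ennreal (b ^ (n - 2) * exp (- (real n / 4 * b\<^sup>2))) \<partial>lborel)"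
  have G: "G \<noteq> 0" "G < \<infinity>"
    unfolding G_def by (rule nn_integral_gauss_weight)+
  have "A \<noteq> 0"
    unfolding A_def by (rule nn_integral_lborel_neq_0) auto
  moreover have "A < \<infinity>"
    using n nn_integral_gaussian_finite[of "real n / 4" 0] unfolding A_def by simp
  ultimately have A: "A \<noteq> 0" "A < \<infinity>"
    by auto
  have "B \<noteq> 0"
    unfolding B_def by (rule nn_integral_lborel_neq_0) (auto simp: indicator_def)
  moreover have "B \<le> (\<integral>\<^sup>+b. ennreal (\<bar>b\<bar> ^ (n - 2) * exp (- (real n / 4 * b\<^sup>2))) \<partial>lborel)"
    unfolding B_def by (intro nn_integral_mono) (auto simp: indicator_def)
  then have "B < \<infinity>"
    using nn_integral_gaussian_finite[of "real n / 4" "n - 2"] n by (simp add: order.strict_trans1)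
  ultimately have B: "B \<noteq> 0" "B < \<infinity>"
    by auto
  have "orbit_const n * G = (\<integral>\<^sup>+y. ennreal (gauss_weight n y) *
      (\<integral>\<^sup>+b. \<integral>\<^sup>+a. indicator {0<..} b * (ennreal (b ^ (n - 2)) *
        ennreal (gauss_weight n (affine_sample n a b (standardize n y)))) \<partial>lborel \<partial>lborel) \<partial>lebesgue_n n)"
    unfolding G_def using n by (intro orbit_average) measurable
  also have "\<dots> = (\<integral>\<^sup>+y. ennreal (gauss_weight n y) * (B * A) \<partial>lebesgue_n n)"
  proof (rule nn_integral_cong_AE, rule AE_mp[OF AE_sample_sd_pos[OF n]], intro AE_I2 impI)
    fix y assume s: "sample_sd n y > 0"
    have "(\<integral>\<^sup>+b. \<integral>\<^sup>+a. indicator {0<..} b * (ennreal (b ^ (n - 2)) *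
        ennreal (gauss_weight n (affine_sample n a b (standardize n y)))) \<partial>lborel \<partial>lborel) =
      (\<integral>\<^sup>+b. \<integral>\<^sup>+a. (indicator {0<..} b * ennreal (b ^ (n - 2) * exp (- (real n / 4 * b\<^sup>2)))) *
        ennreal (exp (- (real n / 4 * a\<^sup>2))) \<partial>lborel \<partial>lborel)"
    proof (rule nn_integral_cong, rule nn_integral_cong)
      fix b a :: real
      show "indicator {0<..} b * (ennreal (b ^ (n - 2)) *
          ennreal (gauss_weight n (affine_sample n a b (standardize n y)))) =
        (indicator {0<..} b * ennreal (b ^ (n - 2) * exp (- (real n / 4 * b\<^sup>2)))) *
          ennreal (exp (- (real n / 4 * a\<^sup>2)))"
      proof (cases "b > 0")
        case True
        have "exp (- (real n * (a\<^sup>2 + b\<^sup>2) / 4)) = exp (- (real n / 4 * b\<^sup>2)) * exp (- (real n / 4 * a\<^sup>2))"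
          unfolding exp_add[symmetric] by (rule arg_cong[where f = exp]) (simp add: field_simps)
        then show ?thesis
          using True n s by (simp add: gauss_weight_orbit ennreal_mult' mult.assoc)
      next
        case False
        then have "indicator {0<..} b = (0 :: ennreal)"
          by simp
        then show ?thesis
          by simp
      qed
    qed
    also have "\<dots> = B * A"
      unfolding A_def B_def by (simp add: nn_integral_cmult nn_integral_multc)
    finally show "ennreal (gauss_weight n y) *
      (\<integral>\<^sup>+b. \<integral>\<^sup>+a. indicator {0<..} b * (ennreal (b ^ (n - 2)) *
        ennreal (gauss_weight n (affine_sample n a b (standardize n y)))) \<partial>lborel \<partial>lborel) =
      ennreal (gauss_weight n y) * (B * A)"
      by (rule arg_cong)
  qed
  also have "\<dots> = G * (B * A)"
    unfolding G_def by (intro nn_integral_multc) measurable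
  finally have eq: "orbit_const n * G = G * (B * A)" .
  have "G * (B * A) \<noteq> 0" "G * (B * A) < \<infinity>"
    using G A B by (auto simp: ennreal_mult_less_top)
  then show "0 < orbit_const n" "orbit_const n < \<infinity>"
    using G unfolding eq[symmetric] by (auto simp: zero_less_iff_neq_zero ennreal_mult_less_top ennreal_mult_eq_top_iff less_top)
qed

section \<open>The power derivative of an invariant region\<close>

lemma iterated_integral_pos_neg:
  fixes f :: "real \<Rightarrow> real \<Rightarrow> real"
  assumes f [measurable]: "case_prod f \<in> borel_measurable (lborel \<Otimes>\<^sub>M lborel)"
    and pos: "(\<integral>\<^sup>+b. \<integral>\<^sup>+a. ennreal (f b a) \<partial>lborel \<partial>lborel) < \<infinity>"
    and neg: "(\<integral>\<^sup>+b. \<integral>\<^sup>+a. ennreal (- f b a) \<partial>lborel \<partial>lborel) < \<infinity>"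
  shows "(LINT b|lborel. LINT a|lborel. f b a) =
    enn2real (\<integral>\<^sup>+b. \<integral>\<^sup>+a. ennreal (f b a) \<partial>lborel \<partial>lborel) -
    enn2real (\<integral>\<^sup>+b. \<integral>\<^sup>+a. ennreal (- f b a) \<partial>lborel \<partial>lborel)"
proof -
  let ?g = "case_prod f"
  have P: "(\<integral>\<^sup>+p. ennreal (?g p) \<partial>(lborel \<Otimes>\<^sub>M lborel)) = (\<integral>\<^sup>+b. \<integral>\<^sup>+a. ennreal (f b a) \<partial>lborel \<partial>lborel)"
    by (subst lborel.nn_integral_fst[symmetric]) auto
  have N: "(\<integral>\<^sup>+p. ennreal (- ?g p) \<partial>(lborel \<Otimes>\<^sub>M lborel)) = (\<integral>\<^sup>+b. \<integral>\<^sup>+a. ennreal (- f b a) \<partial>lborel \<partial>lborel)"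
    by (subst lborel.nn_integral_fst[symmetric]) (auto simp: case_prod_beta)
  have int: "integrable (lborel \<Otimes>\<^sub>M lborel) ?g"
    unfolding real_integrable_def P N using f pos neg by (simp add: less_top)
  have "(LINT b|lborel. LINT a|lborel. f b a) = integral\<^sup>L (lborel \<Otimes>\<^sub>M lborel) ?g"
    using lborel_pair.integral_fst'[OF int] by simp
  then show ?thesis
    unfolding real_lebesgue_integral_def[OF int] P N .
qed

text \<open>
  Used with the difference of two power functions: a positive value at \<open>0\<close> persists by continuity, and
  a zero value is followed by positive ones if the derivative is positive.
\<close>

lemma eventually_nonneg_of_right_derivative:
  fixes g :: "real \<Rightarrow> real"
  assumes lim: "((\<lambda>\<theta>. (g \<theta> - g 0) / \<theta>) \<longlongrightarrow> d) (at_right 0)"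
    and g0: "g 0 \<ge> 0" and d: "g 0 = 0 \<Longrightarrow> d > 0"
  shows "\<forall>\<^sub>F \<theta> in at_right 0. g \<theta> \<ge> 0"
proof (cases "g 0 = 0")
  case True
  from order_tendstoD(1)[OF lim d[OF True]] eventually_at_right_less[of 0] show ?thesis
    by eventually_elim (simp add: True zero_less_divide_iff)
next
  case False
  have "((\<lambda>\<theta>. \<theta>) \<longlongrightarrow> (0::real)) (at_right 0)"
    by (rule tendsto_ident_at)
  then have "((\<lambda>\<theta>. g 0 + (g \<theta> - g 0) / \<theta> * \<theta>) \<longlongrightarrow> g 0 + d * 0) (at_right 0)"
    by (intro tendsto_intros lim)
  moreover have "g 0 + d * 0 > 0"
    using False g0 by simp
  ultimately have "\<forall>\<^sub>F \<theta> in at_right 0. g 0 + (g \<theta> - g 0) / \<theta> * \<theta> > 0"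
    by (rule order_tendstoD(1))
  then show ?thesis
    using eventually_at_right_less[of 0] by eventually_elim simp
qed

lemma T_stat_eq:
  "T_stat n \<beta> z = (LINT b|lborel. LINT a|lborel. indicator {0<..} b *
     (b ^ (n - 2) * (sample_score n \<beta> (affine_sample n a b z) * exp (- (real n * (a\<^sup>2 + b\<^sup>2) / 4)))))"
proof -
  have "sample_score n \<beta> (affine_sample n a b z) = (\<Sum>i<n. score0 \<beta> (a + b * z i))" for a b
    by (simp add: sample_score_def affine_sample_apply)
  moreover have "indicator {0<..} b *\<^sub>R (LINT a|lborel. F a) = (LINT a|lborel. indicator {0<..} b * F a)"
    for b :: real and F :: "real \<Rightarrow> real"
    by simp
  ultimately show ?thesis
    unfolding T_stat_def set_lebesgue_integral_def by (simp add: mult_ac)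
qed

lemma T_stat_cong:
  assumes "\<And>i. i < n \<Longrightarrow> z i = z' i"
  shows "T_stat n \<beta> z = T_stat n \<beta> z'"
proof -
  have "affine_sample n a b z = affine_sample n a b z'" for a b
    unfolding affine_sample_def using assms by (intro restrict_ext) simp
  then show ?thesis
    by (simp add: T_stat_eq)
qed

lemma T_stat_standardize_measurable:
  assumes "\<bar>\<beta>\<bar> \<le> 1"
  shows "(\<lambda>x. T_stat n \<beta> (standardize n x)) \<in> borel_measurable (lebesgue_n n)"
proof -
  note sample_score_measurable[OF assms, measurable]
  show ?thesis
    unfolding T_stat_eq by measurable
qed

text \<open>
  The points \<open>a + b z(y)\<close> with \<open>b > 0\<close> lie on the orbit of \<open>y\<close>.
\<close>

lemma invariant_region_orbit:
  assumes R: "invariant_region n R" and y: "y \<in> space (lebesgue_n n)" "sample_sd n y > 0" and b: "b > 0"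
  shows "affine_sample n a b (standardize n y) \<in> R \<longleftrightarrow> y \<in> R"
  using R y b unfolding orbit_affine_standardize[OF y(2)] invariant_region_def space_lebesgue_n by simp

text \<open>
  Up to the constant, \<open>T(z)\<close> is the conditional expectation of the sample score given the
  standardized sample. The identity \<open>orbit_average\<close> is applied to the positive and the negative part
  of the score on \<open>R\<close>. Applied to the whole sample space, it also shows that the double integral
  that defines \<open>T(z)\<close> converges absolutely for almost every sample.
\<close>

lemma integral_invariant_score:
  assumes n: "n \<ge> 2" and \<beta>: "\<bar>\<beta>\<bar> \<le> 1" and R: "invariant_region n R"
  shows "integrable (lebesgue_n n) (\<lambda>x. indicator R x * (T_stat n \<beta> (standardize n x) * joint n \<beta> 0 x))"
    and "enn2real (orbit_const n) * (LINT x|lebesgue_n n. indicator R x * (sample_score n \<beta> x * joint n \<beta> 0 x)) =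
      (LINT x|lebesgue_n n. indicator R x * (T_stat n \<beta> (standardize n x) * joint n \<beta> 0 x))"
proof -
  define c where "c = (1 / (2 * sqrt pi)) ^ n"
  have c: "c > 0"
    by (simp add: c_def)
  have joint: "joint n \<beta> 0 x = c * gauss_weight n x" for x
    by (simp add: joint_0_eq c_def)
  note [measurable] = sample_score_measurable[OF \<beta>] T_stat_standardize_measurable[OF \<beta>]
  have R_sets [measurable]: "R \<in> sets (lebesgue_n n)"
    using R by (simp add: invariant_region_def sets_lebesgue_n)
  define f where "f y b a = indicator {0<..} b * (b ^ (n - 2) *
      (sample_score n \<beta> (affine_sample n a b (standardize n y)) * exp (- (real n * (a\<^sup>2 + b\<^sup>2) / 4))))"
    for y :: "nat \<Rightarrow> real" and b a :: real
  have f_measurable: "(\<lambda>(b, a). f y b a) \<in> borel_measurable (lborel \<Otimes>\<^sub>M lborel)" for y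
    unfolding f_def by measurable
  define I where "I \<sigma> y = (\<integral>\<^sup>+b. \<integral>\<^sup>+a. ennreal (\<sigma> * f y b a) \<partial>lborel \<partial>lborel)" for \<sigma> y
  have [measurable]: "I \<sigma> \<in> borel_measurable (lebesgue_n n)" for \<sigma>
    unfolding I_def f_def by measurable
  define h where "h S x = indicator S x * (sample_score n \<beta> x * gauss_weight n x)" for S x
  have h_measurable: "h S \<in> borel_measurable (lebesgue_n n)" if [measurable]: "S \<in> sets (lebesgue_n n)" for S
    unfolding h_def by measurable
  have h_integrable: "integrable (lebesgue_n n) (h S)" if "S \<in> sets (lebesgue_n n)" for S
  proof -
    have "integrable (lebesgue_n n) (\<lambda>x. (1 / c) * (sample_score n \<beta> x * joint n \<beta> 0 x))"
      by (intro integrable_mult_right integrable_score_joint \<beta>)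
    also have "(\<lambda>x. (1 / c) * (sample_score n \<beta> x * joint n \<beta> 0 x)) = (\<lambda>x. sample_score n \<beta> x * gauss_weight n x)"
      using c by (simp add: joint fun_eq_iff)
    finally have "integrable (lebesgue_n n) (\<lambda>x. sample_score n \<beta> x * gauss_weight n x)" .
    from integrable_mult_indicator[OF that this] show ?thesis
      by (simp add: h_def[abs_def])
  qed
  (* the sign \<sigma> selects the positive or the negative part, because ennreal truncates at 0 *)
  have average: "orbit_const n * (\<integral>\<^sup>+x. ennreal (\<sigma> * h S x) \<partial>lebesgue_n n) =
      (\<integral>\<^sup>+y. indicator S y * (ennreal (gauss_weight n y) * I \<sigma> y) \<partial>lebesgue_n n)"
    if S: "invariant_region n S" for \<sigma> S
  proof -
    have [measurable]: "S \<in> sets (lebesgue_n n)"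
      using S by (simp add: invariant_region_def sets_lebesgue_n)
    note h_measurable[measurable]
    have "orbit_const n * (\<integral>\<^sup>+x. ennreal (\<sigma> * h S x) \<partial>lebesgue_n n) =
        (\<integral>\<^sup>+y. ennreal (gauss_weight n y) *
          (\<integral>\<^sup>+b. \<integral>\<^sup>+a. indicator {0<..} b * (ennreal (b ^ (n - 2)) *
            ennreal (\<sigma> * h S (affine_sample n a b (standardize n y)))) \<partial>lborel \<partial>lborel) \<partial>lebesgue_n n)"
      using n by (intro orbit_average) measurable
    also have "\<dots> = (\<integral>\<^sup>+y. indicator S y * (ennreal (gauss_weight n y) * I \<sigma> y) \<partial>lebesgue_n n)"
    proof (rule nn_integral_cong_AE, rule AE_mp[OF AE_sample_sd_pos[OF n]], intro AE_I2 impI)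
      fix y assume y: "y \<in> space (lebesgue_n n)" "sample_sd n y > 0"
      have "indicator {0<..} b * (ennreal (b ^ (n - 2)) *
            ennreal (\<sigma> * h S (affine_sample n a b (standardize n y)))) =
          indicator S y * ennreal (\<sigma> * f y b a)" for b a
      proof (cases "b > 0")
        case True
        have eq: "b ^ (n - 2) * (\<sigma> * h S (affine_sample n a b (standardize n y))) =
            indicator S y * (\<sigma> * f y b a)"
          using True n y invariant_region_orbit[OF S y True]
          by (simp add: h_def f_def gauss_weight_orbit indicator_def)
        have "indicator {0<..} b * (ennreal (b ^ (n - 2)) *
            ennreal (\<sigma> * h S (affine_sample n a b (standardize n y)))) =
            ennreal (b ^ (n - 2) * (\<sigma> * h S (affine_sample n a b (standardize n y))))"
          using True by (simp add: ennreal_mult')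
        also have "\<dots> = indicator S y * ennreal (\<sigma> * f y b a)"
          unfolding eq by (simp add: indicator_def)
        finally show ?thesis .
      next
        case False
        then have "indicator {0<..} b = (0 :: ennreal)" "f y b a = 0"
          by (simp_all add: f_def)
        then show ?thesis
          by simp
      qed
      moreover have [measurable]: "(\<lambda>(b, a). f y b a) \<in> borel_measurable (lborel \<Otimes>\<^sub>M lborel)"
        by (rule f_measurable)
      have "(\<integral>\<^sup>+b. \<integral>\<^sup>+a. indicator S y * ennreal (\<sigma> * f y b a) \<partial>lborel \<partial>lborel) = indicator S y * I \<sigma> y"
        unfolding I_def by (simp add: nn_integral_cmult)
      ultimately show "ennreal (gauss_weight n y) *
          (\<integral>\<^sup>+b. \<integral>\<^sup>+a. indicator {0<..} b * (ennreal (b ^ (n - 2)) *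
            ennreal (\<sigma> * h S (affine_sample n a b (standardize n y)))) \<partial>lborel \<partial>lborel) =
          indicator S y * (ennreal (gauss_weight n y) * I \<sigma> y)"
        by (simp add: mult_ac)
    qed
    finally show ?thesis .
  qed
  have finite: "(\<integral>\<^sup>+x. ennreal (\<sigma> * h S x) \<partial>lebesgue_n n) < \<infinity>" if "S \<in> sets (lebesgue_n n)" for \<sigma> S
    using integrableD(2)[OF integrable_mult_right[OF h_integrable[OF that], of \<sigma>]]
    by (simp add: less_top)
  have inv_space: "invariant_region n (space (lebesgue_n n))"
    unfolding invariant_region_def space_lebesgue_n
    by (auto simp: affine_sample_def space_PiM)
  have I_finite: "AE y in lebesgue_n n. I \<sigma> y < \<infinity>" for \<sigma>
  proof -
    have "(\<integral>\<^sup>+y. indicator (space (lebesgue_n n)) y * (ennreal (gauss_weight n y) * I \<sigma> y) \<partial>lebesgue_n n) \<noteq> \<infinity>"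
      unfolding average[OF inv_space, symmetric]
      using orbit_const_pos_finite[OF n] finite[of "space (lebesgue_n n)" \<sigma>]
      by (auto simp: ennreal_mult_eq_top_iff less_top)
    then have "AE y in lebesgue_n n. indicator (space (lebesgue_n n)) y * (ennreal (gauss_weight n y) * I \<sigma> y) \<noteq> \<infinity>"
      by (intro nn_integral_PInf_AE) measurable
    then show ?thesis
      by (rule AE_mp)
        (auto intro!: AE_I2 simp: ennreal_mult_eq_top_iff less_top less_imp_neq[OF gauss_weight_pos(1), symmetric])
  qed
  define g where "g \<sigma> y = indicator R y * (gauss_weight n y * enn2real (I \<sigma> y))" for \<sigma> y
  have g_measurable: "g \<sigma> \<in> borel_measurable (lebesgue_n n)" for \<sigma>
    unfolding g_def by measurable
  have g_nn: "(\<integral>\<^sup>+y. ennreal (g \<sigma> y) \<partial>lebesgue_n n) = orbit_const n * (\<integral>\<^sup>+x. ennreal (\<sigma> * h R x) \<partial>lebesgue_n n)" for \<sigma>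
    unfolding average[OF R]
  proof (rule nn_integral_cong_AE, rule AE_mp[OF I_finite[of \<sigma>]], intro AE_I2 impI)
    fix y assume "I \<sigma> y < \<infinity>"
    then show "ennreal (g \<sigma> y) = indicator R y * (ennreal (gauss_weight n y) * I \<sigma> y)"
      by (simp add: g_def indicator_def ennreal_mult' ennreal_enn2real less_top)
  qed
  have g_nonneg: "g \<sigma> y \<ge> 0" for \<sigma> y
    by (simp add: g_def)
  have g_integrable: "integrable (lebesgue_n n) (g \<sigma>)" for \<sigma>
  proof (rule integrableI_nonneg)
    show "(\<integral>\<^sup>+y. ennreal (g \<sigma> y) \<partial>lebesgue_n n) < \<infinity>"
      unfolding g_nn using orbit_const_pos_finite[OF n] finite[OF R_sets, of \<sigma>]
      by (simp add: ennreal_mult_less_top)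
  qed (use g_measurable g_nonneg in auto)
  have g_integral: "(LINT y|lebesgue_n n. g \<sigma> y) =
      enn2real (orbit_const n) * enn2real (\<integral>\<^sup>+x. ennreal (\<sigma> * h R x) \<partial>lebesgue_n n)" for \<sigma>
    using g_measurable g_nonneg by (subst integral_eq_nn_integral) (auto simp: g_nn enn2real_mult)
  have T: "AE y in lebesgue_n n. c * (g 1 y - g (- 1) y) = indicator R y * (T_stat n \<beta> (standardize n y) * joint n \<beta> 0 y)"
    using I_finite[of 1] I_finite[of "- 1"]
  proof eventually_elim
    fix y assume fin: "I 1 y < \<infinity>" "I (- 1) y < \<infinity>"
    have T_eq: "T_stat n \<beta> (standardize n y) = enn2real (I 1 y) - enn2real (I (- 1) y)"
      using iterated_integral_pos_neg[OF f_measurable[of y]] fin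
      unfolding T_stat_eq f_def[symmetric] I_def by simp
    show "c * (g 1 y - g (- 1) y) = indicator R y * (T_stat n \<beta> (standardize n y) * joint n \<beta> 0 y)"
      unfolding T_eq by (simp add: g_def joint algebra_simps)
  qed
  have int: "integrable (lebesgue_n n) (\<lambda>y. c * (g 1 y - g (- 1) y))"
    by (intro integrable_mult_right Bochner_Integration.integrable_diff g_integrable)
  show "integrable (lebesgue_n n) (\<lambda>x. indicator R x * (T_stat n \<beta> (standardize n x) * joint n \<beta> 0 x))"
    by (rule integrable_cong_AE_imp[OF int]) (use T in auto)
  have "(LINT x|lebesgue_n n. indicator R x * (T_stat n \<beta> (standardize n x) * joint n \<beta> 0 x)) =
      (LINT y|lebesgue_n n. c * (g 1 y - g (- 1) y))"
    using T g_measurable by (intro integral_cong_AE) (auto elim: eventually_mono)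
  also have "\<dots> = c * (enn2real (orbit_const n) * (enn2real (\<integral>\<^sup>+x. ennreal (h R x) \<partial>lebesgue_n n) -
      enn2real (\<integral>\<^sup>+x. ennreal (- h R x) \<partial>lebesgue_n n)))"
    using g_integrable by (simp add: g_integral right_diff_distrib)
  also have "\<dots> = enn2real (orbit_const n) * (c * (LINT x|lebesgue_n n. h R x))"
    unfolding real_lebesgue_integral_def[OF h_integrable[OF R_sets]] by simp
  also have "c * (LINT x|lebesgue_n n. h R x) =
      (LINT x|lebesgue_n n. indicator R x * (sample_score n \<beta> x * joint n \<beta> 0 x))"
    unfolding h_def joint by (subst integral_mult_right_zero[symmetric]) (simp add: mult_ac)
  finally show "enn2real (orbit_const n) * (LINT x|lebesgue_n n. indicator R x * (sample_score n \<beta> x * joint n \<beta> 0 x)) =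
      (LINT x|lebesgue_n n. indicator R x * (T_stat n \<beta> (standardize n x) * joint n \<beta> 0 x))" ..
qed

lemma invariant_region_T_stat:
  assumes n: "n > 0" and \<beta>: "\<bar>\<beta>\<bar> \<le> 1"
  shows "invariant_region n {x \<in> space (sample_space n). T_stat n \<beta> (standardize n x) > k}"
  unfolding invariant_region_def
proof (intro conjI ballI allI impI)
  note T_stat_standardize_measurable[OF \<beta>, measurable]
  have "{x \<in> space (lebesgue_n n). T_stat n \<beta> (standardize n x) > k} \<in> sets (lebesgue_n n)"
    by measurable
  then show "{x \<in> space (sample_space n). T_stat n \<beta> (standardize n x) > k} \<in> sets (sample_space n)"
    by (simp add: sets_lebesgue_n space_lebesgue_n)
  fix x a and b :: real assume "x \<in> space (sample_space n)" "b > 0"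
  moreover from this have "T_stat n \<beta> (standardize n (affine_sample n a b x)) = T_stat n \<beta> (standardize n x)"
    using n by (intro T_stat_cong) (simp add: standardize_affine)
  moreover have "affine_sample n a b x \<in> space (sample_space n)"
    by (simp add: affine_sample_def space_PiM)
  ultimately show "x \<in> {x \<in> space (sample_space n). T_stat n \<beta> (standardize n x) > k} \<longleftrightarrow>
      affine_sample n a b x \<in> {x \<in> space (sample_space n). T_stat n \<beta> (standardize n x) > k}"
    by simp
qed

lemma joint_0_pos: "joint n \<beta> 0 x > 0"
  by (simp add: joint_0_eq)

section \<open>The locally best invariant test\<close>

theorem theorem2:
  fixes n :: nat and \<beta> a b k :: real
  assumes "n \<ge> 3" and "\<bar>\<beta>\<bar> \<le> 1" and "b > 0"
  shows "lbi_region n (stable_sample n \<beta> a b)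
           {x \<in> space (sample_space n). T_stat n \<beta> (standardize n x) > k}"
proof -
  define T where "T x = T_stat n \<beta> (standardize n x)" for x
  define R where "R = {x \<in> space (sample_space n). T x > k}"
  define p where "p S \<theta> = (LINT x|lebesgue_n n. indicator S x * joint n \<beta> \<theta> x)" for S \<theta>
  define D where "D S = (LINT x|lebesgue_n n. indicator S x * (sample_score n \<beta> x * joint n \<beta> 0 x))" for S
  define \<kappa> where "\<kappa> = enn2real (orbit_const n)"
  have n: "n \<ge> 2"
    using assms(1) by simp
  have \<kappa>: "\<kappa> > 0"
    using orbit_const_pos_finite[OF n] by (simp add: \<kappa>_def enn2real_positive_iff)
  have R: "invariant_region n R"
    unfolding R_def T_def using invariant_region_T_stat[of n \<beta> k] n assms(2) by simp
  have sets: "S \<in> sets (lebesgue_n n)" if "invariant_region n S" for S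
    using that by (simp add: invariant_region_def sets_lebesgue_n)
  have measure_eq: "measure (stable_sample n \<beta> a b \<theta>) S = p S \<theta>"
    if "invariant_region n S" "\<theta> \<in> {0..1/20}" for S \<theta>
    unfolding stable_sample_invariant[OF that(1) assms(3)] p_def
    by (rule measure_stable_sample[OF assms(2) that(2) sets[OF that(1)]])
  have p_int: "integrable (lebesgue_n n) (\<lambda>x. indicator S x * joint n \<beta> \<theta> x)"
    if "invariant_region n S" "\<theta> \<in> {0..1/20}" for S \<theta>
    using integrable_mult_indicator[OF sets[OF that(1)] integrable_joint[OF assms(2) that(2)]] by simp
  have T_int: "integrable (lebesgue_n n) (\<lambda>x. indicator S x * (T x * joint n \<beta> 0 x))"
    and T_integral: "(LINT x|lebesgue_n n. indicator S x * (T x * joint n \<beta> 0 x)) = \<kappa> * D S"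
    if "invariant_region n S" for S
    using integral_invariant_score[OF n assms(2) that] by (simp_all add: T_def \<kappa>_def D_def)
  have "\<exists>\<theta>0>0. \<forall>\<theta>. 0 < \<theta> \<and> \<theta> < \<theta>0 \<longrightarrow>
      measure (stable_sample n \<beta> a b \<theta>) R' \<le> measure (stable_sample n \<beta> a b \<theta>) R"
    if R': "invariant_region n R'"
      and size: "measure (stable_sample n \<beta> a b 0) R' \<le> measure (stable_sample n \<beta> a b 0) R" for R'
  proof -
    note RR' = R R'
    have R_sets [measurable]: "R \<in> sets (lebesgue_n n)" "R' \<in> sets (lebesgue_n n)"
      using RR' by (auto intro: sets)
    define g where "g \<theta> = p R \<theta> - p R' \<theta>" for \<theta>
    have g0: "g 0 \<ge> 0"
      using size measure_eq[OF R, of 0] measure_eq[OF R', of 0] by (simp add: g_def)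
    have deriv: "((\<lambda>\<theta>. (g \<theta> - g 0) / \<theta>) \<longlongrightarrow> D R - D R') (at_right 0)"
    proof -
      have "((\<lambda>\<theta>. (p R \<theta> - p R 0) / \<theta> - (p R' \<theta> - p R' 0) / \<theta>) \<longlongrightarrow> D R - D R') (at_right 0)"
        unfolding p_def D_def
        by (intro tendsto_diff integral_joint_right_derivative assms(2) R_sets)
      also have "(\<lambda>\<theta>. (p R \<theta> - p R 0) / \<theta> - (p R' \<theta> - p R' 0) / \<theta>) = (\<lambda>\<theta>. (g \<theta> - g 0) / \<theta>)"
        by (simp add: g_def fun_eq_iff diff_divide_distrib)
      finally show ?thesis .
    qed
    have "\<forall>\<^sub>F \<theta> in at_right 0. g \<theta> \<ge> 0"
    (* only in the exceptional case are the regions compared: there they must agree almost everywhere *)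
    proof (cases "g 0 = 0 \<and> D R \<le> D R'")
      case False
      then show ?thesis
        by (intro eventually_nonneg_of_right_derivative[OF deriv g0]) auto
    next
      case True
      (* the Neyman-Pearson integrand; T > k exactly on R makes it nonnegative *)
      define \<phi> where "\<phi> x = (indicator R x - indicator R' x) * ((T x - k) * joint n \<beta> 0 x)" for x :: "nat \<Rightarrow> real"
      (* R is almost contained in R', and equality of the sizes excludes a larger R' *)
      define \<psi> where "\<psi> x = (indicator R' x - indicator R x) * joint n \<beta> 0 x" for x :: "nat \<Rightarrow> real"
      have \<phi>_eq: "\<phi> = (\<lambda>x. (indicator R x * (T x * joint n \<beta> 0 x) - indicator R' x * (T x * joint n \<beta> 0 x)) -
          k * (indicator R x * joint n \<beta> 0 x - indicator R' x * joint n \<beta> 0 x))"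
        by (simp add: \<phi>_def fun_eq_iff algebra_simps)
      have \<phi>_int: "integrable (lebesgue_n n) \<phi>"
        unfolding \<phi>_eq
        by (intro Bochner_Integration.integrable_diff integrable_mult_right T_int p_int RR') auto
      have "integral\<^sup>L (lebesgue_n n) \<phi> = \<kappa> * (D R - D R') - k * g 0"
        unfolding \<phi>_eq g_def p_def using T_int[OF R] T_int[OF R'] p_int[OF R, of 0] p_int[OF R', of 0]
        by (simp add: T_integral[OF R] T_integral[OF R'] right_diff_distrib)
      also have "\<dots> \<le> 0"
        using True \<kappa> by (simp add: mult_nonneg_nonpos)
      finally have le: "integral\<^sup>L (lebesgue_n n) \<phi> \<le> 0" .
      have "x \<in> R \<longleftrightarrow> k < T x" if "x \<in> space (lebesgue_n n)" for x
        using that by (simp add: R_def space_lebesgue_n)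
      then have \<phi>_nonneg: "AE x in lebesgue_n n. 0 \<le> \<phi> x"
        by (intro AE_I2) (auto simp: \<phi>_def indicator_def intro: mult_nonpos_nonneg)
      have "integral\<^sup>L (lebesgue_n n) \<phi> = 0"
        using le integral_nonneg_AE[OF \<phi>_nonneg] by simp
      then have "AE x in lebesgue_n n. \<phi> x = 0"
        using integral_nonneg_eq_0_iff_AE[OF \<phi>_int \<phi>_nonneg] by simp
      then have sub: "AE x in lebesgue_n n. x \<in> R \<longrightarrow> x \<in> R'"
        by eventually_elim
          (use joint_0_pos[of n \<beta>] in \<open>auto simp: \<phi>_def R_def indicator_def less_imp_neq[symmetric] split: if_splits\<close>)
      have \<psi>_eq: "\<psi> = (\<lambda>x. indicator R' x * joint n \<beta> 0 x - indicator R x * joint n \<beta> 0 x)"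
        by (simp add: \<psi>_def fun_eq_iff algebra_simps)
      have \<psi>_int: "integrable (lebesgue_n n) \<psi>"
        unfolding \<psi>_eq by (intro Bochner_Integration.integrable_diff p_int RR') auto
      have "integral\<^sup>L (lebesgue_n n) \<psi> = - g 0"
        unfolding \<psi>_eq g_def p_def using p_int[OF R, of 0] p_int[OF R', of 0] by simp
      then have "integral\<^sup>L (lebesgue_n n) \<psi> = 0"
        using True by simp
      moreover have "AE x in lebesgue_n n. 0 \<le> \<psi> x"
        using sub by eventually_elim (auto simp: \<psi>_def indicator_def)
      ultimately have "AE x in lebesgue_n n. \<psi> x = 0"
        using integral_nonneg_eq_0_iff_AE[OF \<psi>_int] by simp
      then have AE_eq: "AE x in lebesgue_n n. indicator R x = (indicator R' x :: real)"
        by eventually_elim (use joint_0_pos[of n \<beta>] in \<open>auto simp: \<psi>_def less_imp_neq[symmetric]\<close>)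
      have "p R \<theta> = p R' \<theta>" for \<theta>
        unfolding p_def by (rule integral_cong_AE) (use AE_eq in \<open>auto elim: eventually_mono\<close>)
      then show ?thesis
        by (simp add: g_def)
    qed
    then have "\<forall>\<^sub>F \<theta> in at_right 0. g \<theta> \<ge> 0 \<and> \<theta> < 1 / 20"
      by (intro eventually_conj order_tendstoD(2)[OF tendsto_ident_at]) auto
    then obtain \<theta>0 where \<theta>0: "\<theta>0 > 0" "\<And>\<theta>. 0 < \<theta> \<Longrightarrow> \<theta> < \<theta>0 \<Longrightarrow> g \<theta> \<ge> 0 \<and> \<theta> < 1 / 20"
      unfolding eventually_at_right_field by blast
    show ?thesis
    proof (intro exI[of _ \<theta>0] conjI allI impI \<theta>0(1))
      fix \<theta> assume "0 < \<theta> \<and> \<theta> < \<theta>0"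
      then have "g \<theta> \<ge> 0" "\<theta> \<in> {0..1/20}"
        using \<theta>0(2)[of \<theta>] by auto
      then show "measure (stable_sample n \<beta> a b \<theta>) R' \<le> measure (stable_sample n \<beta> a b \<theta>) R"
        by (simp only: measure_eq[OF R] measure_eq[OF R']) (simp add: g_def)
    qed
  qed
  then show ?thesis
    using R unfolding lbi_region_def R_def T_def by blast
qed

end
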